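(* Let $\kappa>0$, $R>0$, and let $\boldsymbol J\in H(\mathrm{div};\mathrm{grad};B_R)$ be a source with compact support contained in $B_R$. Then $\boldsymbol J$ is nonradiating if and only if $\boldsymbol J\in\mathcal N_3(R)$.
   Context: $B_R=\{x\in\mathbb R^3:|x|<R\}$, $\kappa>0$ is the wavenumber, $g(x,y)=\frac{e^{\mathrm i\kappa|x-y|}}{4\pi|x-y|}$, and $\boldsymbol G(x,y)=[\boldsymbol I+\kappa^{-2}\nabla\nabla]g(x,y)$ is the $3\times3$ dyadic Green's tensor of Maxwell's equations ($\nabla\nabla$ is the Hessian). The electric field generated by $\boldsymbol J$ is $\boldsymbol E(x)=\int_{B_R}\boldsymbol G(x,y)\boldsymbol J(y)\,\mathrm dy$, the solution of $\nabla\times(\nabla\times\boldsymbol E)-\kappa^2\boldsymbol E=\boldsymbol J$ satisfying the Silver--Müller radiation condition. A source $\boldsymbol J$ with compact support contained in $B_R$ is called nonradiating if this $\boldsymbol E$ is identically zero outside $B_R$. $H(\mathrm{div};\mathrm{grad};B_R)=\{\boldsymbol\Psi\in(L^2(B_R))^3:\nabla(\nabla\cdot\boldsymbol\Psi)\in(L^2(B_R))^3\}$. Let $j_0$ be the spherical Bessel function of order $0$. A source $\boldsymbol J\in H(\mathrm{div};\mathrm{grad};B_R)$ belongs to the null space $\mathcal N_3(R)$ if $$\int_{B_R}j_0(\kappa|x-y|)\big(\boldsymbol J(y)+\kappa^{-2}\nabla(\nabla\cdot\boldsymbol J(y))\big)\,\mathrm dy=0\quad\text{for all }|x|>R.$$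 *)

theory Defs
  imports "HOL-Analysis.Analysis"
begin

definition partial :: "'n::finite \<Rightarrow> (real^'n \<Rightarrow> 'b::real_normed_vector) \<Rightarrow> real^'n \<Rightarrow> 'b" where
  "partial i f x = frechet_derivative f (at x) (axis i 1)"

(* Infinitely differentiable: every iterated partial derivative is (Frechet) differentiable. *)
definition smooth :: "(real^'n::finite \<Rightarrow> 'b::real_normed_vector) \<Rightarrow> bool" where
  "smooth f \<longleftrightarrow> (\<forall>is x. foldr partial is f differentiable (at x))"

definition test_functions :: "(real^'n::finite) set \<Rightarrow> (real^'n \<Rightarrow> complex) set" where
  "test_functions \<Omega> = {\<phi>. smooth \<phi> \<and> compact (closure {x. \<phi> x \<noteq> 0}) \<and> closure {x. \<phi> x \<noteq> 0} \<subseteq> \<Omega>}"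

(* Elements of L^2(Omega) are represented by functions on the whole space;
   their values outside Omega are irrelevant in every definition below. *)
definition L2_on :: "(real^'n::finite) set \<Rightarrow> (real^'n \<Rightarrow> 'b::euclidean_space) set" where
  "L2_on \<Omega> = {f. f \<in> borel_measurable (lebesgue_on \<Omega>) \<and>
                  integrable (lebesgue_on \<Omega>) (\<lambda>x. (norm (f x))\<^sup>2)}"

(* Support of a Lebesgue class on an open set Omega: the complement in Omega of the
   largest open subset on which the function vanishes almost everywhere. *)
definition ess_support :: "(real^'n::finite) set \<Rightarrow> (real^'n \<Rightarrow> 'b::zero) \<Rightarrow> (real^'n) set" where
  "ess_support \<Omega> f = \<Omega> - \<Union>{U. open U \<and> U \<subseteq> \<Omega> \<and> (AE x in lebesgue_on U. f x = 0)}"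

(* Distributions are represented by functionals, evaluated on test_functions only. *)
type_synonym 'n functional = "(real^'n \<Rightarrow> complex) \<Rightarrow> complex"

definition dist_of_fun :: "(real^'n::finite) set \<Rightarrow> (real^'n \<Rightarrow> complex) \<Rightarrow> 'n functional" where
  "dist_of_fun \<Omega> f \<phi> = (LINT x|lebesgue_on \<Omega>. f x * \<phi> x)"

definition dist_partial :: "'n::finite \<Rightarrow> 'n functional \<Rightarrow> 'n functional" where
  "dist_partial i T \<phi> = - T (partial i \<phi>)"

definition dist_div :: "(real^'n::finite) set \<Rightarrow> (real^'n \<Rightarrow> complex^'n) \<Rightarrow> 'n functional" where
  "dist_div \<Omega> \<Psi> \<phi> = (\<Sum>i\<in>UNIV. dist_partial i (dist_of_fun \<Omega> (\<lambda>x. \<Psi> x $ i)) \<phi>)"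

(* The distributional gradient of the distributional divergence of Psi is the L^2 field W. *)
definition has_grad_div ::
    "(real^'n::finite) set \<Rightarrow> (real^'n \<Rightarrow> complex^'n) \<Rightarrow> (real^'n \<Rightarrow> complex^'n) \<Rightarrow> bool" where
  "has_grad_div \<Omega> \<Psi> W \<longleftrightarrow> W \<in> L2_on \<Omega> \<and>
     (\<forall>i. \<forall>\<phi>\<in>test_functions \<Omega>.
        dist_partial i (dist_div \<Omega> \<Psi>) \<phi> = dist_of_fun \<Omega> (\<lambda>x. W x $ i) \<phi>)"

definition H_div_grad :: "(real^'n::finite) set \<Rightarrow> (real^'n \<Rightarrow> complex^'n) set" where
  "H_div_grad \<Omega> = {\<Psi>. \<Psi> \<in> L2_on \<Omega> \<and> (\<exists>W. has_grad_div \<Omega> \<Psi> W)}"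

(* A representative of grad (div Psi), which is determined up to a null subset of Omega. *)
definition grad_div :: "(real^'n::finite) set \<Rightarrow> (real^'n \<Rightarrow> complex^'n) \<Rightarrow> real^'n \<Rightarrow> complex^'n" where
  "grad_div \<Omega> \<Psi> = (SOME W. has_grad_div \<Omega> \<Psi> W)"

definition green :: "real \<Rightarrow> real^3 \<Rightarrow> real^3 \<Rightarrow> complex" where
  "green \<kappa> x y =
     exp (\<i> * complex_of_real (\<kappa> * norm (x - y))) / complex_of_real (4 * pi * norm (x - y))"

(* The Hessian is taken in x; taking it in y gives the same tensor, as green depends on x - y only. *)
definition green_tensor :: "real \<Rightarrow> real^3 \<Rightarrow> real^3 \<Rightarrow> complex^3^3" where
  "green_tensor \<kappa> x y =
     (\<chi> i j. mat 1 $ i $ j * green \<kappa> x y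
             + (1 / complex_of_real (\<kappa>\<^sup>2)) * partial i (partial j (\<lambda>z. green \<kappa> z y)) x)"

definition electric_field :: "real \<Rightarrow> real \<Rightarrow> (real^3 \<Rightarrow> complex^3) \<Rightarrow> real^3 \<Rightarrow> complex^3" where
  "electric_field \<kappa> R J x = (LINT y|lebesgue_on (ball 0 R). green_tensor \<kappa> x y *v J y)"

(* Meant for sources J with compact support in ball 0 R; then the integrand is
   nonsingular on the support of J for every x considered here. *)
definition nonradiating :: "real \<Rightarrow> real \<Rightarrow> (real^3 \<Rightarrow> complex^3) \<Rightarrow> bool" where
  "nonradiating \<kappa> R J \<longleftrightarrow> (\<forall>x. x \<notin> ball 0 R \<longrightarrow> electric_field \<kappa> R J x = 0)"

definition spherical_bessel_j0 :: "real \<Rightarrow> real" where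
  "spherical_bessel_j0 t = (if t = 0 then 1 else sin t / t)"

definition null_space3 :: "real \<Rightarrow> real \<Rightarrow> (real^3 \<Rightarrow> complex^3) set" where
  "null_space3 \<kappa> R = {J \<in> H_div_grad (ball 0 R). \<forall>x. norm x > R \<longrightarrow>
     (LINT y|lebesgue_on (ball 0 R). spherical_bessel_j0 (\<kappa> * norm (x - y)) *\<^sub>R
        (J y + (1 / \<kappa>\<^sup>2) *\<^sub>R grad_div (ball 0 R) J y)) = 0}"

end

theory Submission
  imports Defs "HOL-Complex_Analysis.Complex_Analysis" "HOL-Real_Asymp.Real_Asymp"
begin

unbundle no fps_syntax

text \<open>
  Let \<open>F\<close> be \<open>J + \<kappa>\<^sup>-\<^sup>2 grad div J\<close>, multiplied by a smooth cutoff that equals \<open>1\<close> near the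
  support of \<open>J\<close> and vanishes near the boundary of the ball, and write \<open>u\<^sub>\<sigma>\<close> for the potential \<open>\<integral> g\<^sub>\<sigma>(x, y) F(y) dy\<close> of
  \<open>F\<close> with the kernel \<open>g\<^sub>\<sigma>(x, y) = exp(i \<sigma> |x - y|) / (4 \<pi> |x - y|)\<close>: outgoing for \<open>\<sigma> = \<kappa>\<close>, incoming
  for \<open>\<sigma> = - \<kappa>\<close>. Moving the Hessian from the Green tensor to \<open>J\<close> shows that \<open>E = u\<^sub>\<kappa>\<close> outside the
  ball (\<open>electric_field_eq_radiated\<close>). Since \<open>j\<^sub>0(\<kappa> |x - y|)\<close> is a multiple of
  \<open>g\<^sub>\<kappa> - g\<^sub>-\<^sub>\<kappa>\<close>, the integral defining the null space is the same multiple of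
  \<open>u\<^sub>\<kappa> - u\<^sub>-\<^sub>\<kappa>\<close> (\<open>bessel_integral_eq_radiated\<close>). So the claim is that, outside the ball,
  \<open>u\<^sub>\<kappa> = 0\<close> is equivalent to \<open>u\<^sub>\<kappa> = u\<^sub>-\<^sub>\<kappa>\<close>.

  This is settled on one ray at a time, by complex analysis in the reciprocal radius. For a unit
  vector \<open>e\<close>, the Atkinson-Wilcox factorisation \<open>u\<^sub>\<sigma>(e / t) = t exp(i \<sigma> / t) A\<^sub>\<sigma>\<^sup>e(t)\<close> holds for small
  \<open>t > 0\<close>, where \<open>A\<^sub>\<sigma>\<^sup>e\<close> is holomorphic in a disc about \<open>0\<close>, because \<open>t |e / t - y|\<close> is a branch of
  the square root of a polynomial in \<open>t\<close> without zeros in that disc. Changing the sign of \<open>t\<close> amounts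
  to changing the signs of \<open>\<sigma>\<close> and \<open>e\<close> (\<open>far_field_reflect\<close>).

  If \<open>u\<^sub>\<kappa> = 0\<close> outside the ball, then \<open>A\<^sub>\<kappa>\<^sup>e\<close> vanishes on a real interval, hence on its whole disc; by the
  reflection so does every \<open>A\<^sub>-\<^sub>\<kappa>\<^sup>e\<close>, and \<open>u\<^sub>-\<^sub>\<kappa> = 0\<close> (\<open>outgoing_zero_imp_incoming_zero\<close>).
  If \<open>u\<^sub>\<kappa> = u\<^sub>-\<^sub>\<kappa>\<close> outside the ball, then \<open>exp(2 i \<kappa> / t) A\<^sub>\<kappa>\<^sup>e(t) = A\<^sub>-\<^sub>\<kappa>\<^sup>e(t)\<close> on the punctured disc; on the
  ray \<open>t = - i \<tau>\<close> the left hand side is \<open>O(exp(- 2 \<kappa> / \<tau>))\<close>, so \<open>A\<^sub>-\<^sub>\<kappa>\<^sup>e\<close> vanishes to infinite order at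
  \<open>0\<close> and is zero (\<open>outgoing_eq_incoming_imp_zero\<close>); by the reflection \<open>u\<^sub>\<kappa> = 0\<close> follows. This replaces Rellich's lemma and the expansion in
  spherical waves.
\<close>

section \<open>Iterated differentiability\<close>

text \<open>
  Counting derivatives turns closure properties of smooth functions into inductions on \<open>k\<close>, and the set
  \<open>U\<close> admits functions with a singularity, such as the Green function.
\<close>

primrec k_diff_on ::
    "nat \<Rightarrow> (real^'n::finite) set \<Rightarrow> (real^'n \<Rightarrow> 'b::real_normed_vector) \<Rightarrow> bool" where
  "k_diff_on 0 U f \<longleftrightarrow> True"
| "k_diff_on (Suc k) U f \<longleftrightarrow>
     (\<forall>x\<in>U. f differentiable (at x)) \<and> (\<forall>i. k_diff_on k U (partial i f))"

lemma partial_eq: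
  assumes "(f has_derivative D) (at x)"
  shows "partial i f x = D (axis i 1)"
  using frechet_derivative_at[OF assms] by (simp add: partial_def)

lemma has_derivative_cong_open:
  assumes "open U" "x \<in> U" "\<And>y. y \<in> U \<Longrightarrow> f y = g y"
  shows "(f has_derivative D) (at x) \<longleftrightarrow> (g has_derivative D) (at x)"
  using assms has_derivative_transform_within_open[of _ _ x UNIV U]
  by (metis (no_types, lifting))

lemma partial_cong_open:
  assumes "open U" "x \<in> U" "\<And>y. y \<in> U \<Longrightarrow> f y = g y"
  shows "partial i f x = partial i g x"
  using has_derivative_cong_open[OF assms] by (simp add: partial_def frechet_derivative_def)

lemma k_diff_on_cong:
  assumes "open U" "\<And>y. y \<in> U \<Longrightarrow> f y = g y"
  shows "k_diff_on k U f \<longleftrightarrow> k_diff_on k U g"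
  using assms(2)
proof (induction k arbitrary: f g)
  case (Suc k)
  have "f differentiable at x \<longleftrightarrow> g differentiable at x" if "x \<in> U" for x
    using has_derivative_cong_open[OF assms(1) that Suc.prems] by (auto simp: differentiable_def)
  moreover have "k_diff_on k U (partial i f) \<longleftrightarrow> k_diff_on k U (partial i g)" for i
    by (rule Suc.IH) (rule partial_cong_open[OF assms(1) _ Suc.prems])
  ultimately show ?case by simp
qed auto

lemma k_diff_on_Suc: "k_diff_on (Suc k) U f \<Longrightarrow> k_diff_on k U f"
proof (induction k arbitrary: f)
  case (Suc k)
  show ?case using Suc.prems Suc.IH[of "partial _ f"] by (metis k_diff_on.simps(2))
qed auto

lemma k_diff_on_subset: "k_diff_on k U f \<Longrightarrow> V \<subseteq> U \<Longrightarrow> k_diff_on k V f"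
  by (induction k arbitrary: f) auto

lemma k_diff_on_Un: "k_diff_on k U f \<Longrightarrow> k_diff_on k V f \<Longrightarrow> k_diff_on k (U \<union> V) f"
  by (induction k arbitrary: f) auto

text \<open>
  Smoothness is stated through lists of directions, where the head is differentiated last, whereas
  \<open>k_diff_on\<close> peels off the derivative taken first; each direction needs its own induction.
\<close>

lemma smooth_iff: "smooth f \<longleftrightarrow> (\<forall>k. k_diff_on k UNIV f)"
proof
  assume s: "smooth f"
  have "k_diff_on k UNIV (foldr partial is f)" for k "is"
  proof (induction k arbitrary: "is")
    case (Suc k)
    show ?case using s Suc.IH[of "_ # is"] by (simp add: smooth_def)
  qed auto
  from this[of _ "[]"] show "\<forall>k. k_diff_on k UNIV f" by simp
next
  assume k: "\<forall>k. k_diff_on k UNIV f"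
  have "\<forall>k. k_diff_on k UNIV (foldr partial is f)" for "is"
  proof (induction "is")
    case (Cons i "is")
    show ?case
    proof
      fix k from Cons have "k_diff_on (Suc k) UNIV (foldr partial is f)" by blast
      then show "k_diff_on k UNIV (foldr partial (i # is) f)" by simp
    qed
  qed (use k in simp)
  then have "k_diff_on (Suc 0) UNIV (foldr partial is f)" for "is" by blast
  then show "smooth f" by (simp add: smooth_def)
qed

lemma has_derivative_frechet: "f differentiable at x \<Longrightarrow> (f has_derivative frechet_derivative f (at x)) (at x)"
  by (simp add: frechet_derivative_works)

lemma k_diff_on_const [simp]: "k_diff_on k U (\<lambda>x::real^'n::finite. c)"
proof (induction k arbitrary: c)
  case (Suc k)
  have "partial i (\<lambda>x::real^'n. c) = (\<lambda>x. 0)" for i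
    by (rule ext, subst partial_eq[where D="\<lambda>h. 0"]) auto
  with Suc show ?case by simp
qed simp

lemma k_diff_on_add:
  assumes "open U" "k_diff_on k U f" "k_diff_on k U g"
  shows "k_diff_on k U (\<lambda>x. f x + g x)"
  using assms(2,3)
proof (induction k arbitrary: f g)
  case (Suc k)
  have "partial i (\<lambda>x. f x + g x) x = partial i f x + partial i g x" if "x \<in> U" for i x
    using Suc.prems that
    by (subst partial_eq[OF has_derivative_add[OF has_derivative_frechet has_derivative_frechet]])
       (auto simp: partial_def)
  then have "k_diff_on k U (partial i (\<lambda>x. f x + g x))" for i
    using Suc.prems by (subst k_diff_on_cong[OF assms(1)]) (auto intro: Suc.IH)
  with Suc.prems show ?case by (auto intro: differentiable_add)
qed simp

lemma partial_mult:
  fixes f g :: "real^'n::finite \<Rightarrow> 'b::real_normed_algebra"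
  assumes "f differentiable at x" "g differentiable at x"
  shows "partial i (\<lambda>x. f x * g x) x = f x * partial i g x + partial i f x * g x"
  by (subst partial_eq[OF has_derivative_mult[OF has_derivative_frechet has_derivative_frechet]])
     (auto simp: partial_def assms)

lemma k_diff_on_mult:
  fixes f g :: "real^'n::finite \<Rightarrow> 'b::real_normed_algebra"
  assumes "open U" "k_diff_on k U f" "k_diff_on k U g"
  shows "k_diff_on k U (\<lambda>x. f x * g x)"
  using assms(2,3)
proof (induction k arbitrary: f g)
  case (Suc k)
  have "k_diff_on k U (partial i (\<lambda>x. f x * g x))" for i
  proof (subst k_diff_on_cong[OF assms(1) partial_mult])
    show "k_diff_on k U (\<lambda>x. f x * partial i g x + partial i f x * g x)"
      using Suc.prems by (intro k_diff_on_add[OF assms(1)] Suc.IH) (auto intro: k_diff_on_Suc)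
  qed (use Suc.prems in auto)
  with Suc.prems show ?case by (auto intro: differentiable_mult)
qed simp

lemma partial_compose_field:
  fixes q :: "real^'n::finite \<Rightarrow> 'a::real_normed_field"
  assumes "(\<zeta> has_field_derivative d) (at (q x))" "q differentiable at x"
  shows "partial i (\<lambda>x. \<zeta> (q x)) x = d * partial i q x"
proof -
  have "((\<lambda>x. \<zeta> (q x)) has_derivative (\<lambda>h. d * frechet_derivative q (at x) h)) (at x)"
    using has_derivative_compose[OF has_derivative_frechet[OF assms(2)]] assms(1)
    by (simp add: has_field_derivative_def)
  from partial_eq[OF this] show ?thesis by (simp add: partial_def)
qed

text \<open>
  The outer function comes as a sequence in which every member is the derivative of the one before:
  differentiating \<open>Z n\<close> composed with \<open>q\<close> leads to \<open>Z (n + 1)\<close>, so the induction on \<open>k\<close> has to cover all \<open>n\<close> at once.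
  Over \<open>real\<close> this serves the cutoffs, over \<open>complex\<close> the holomorphic profile of the Green function.
\<close>

lemma k_diff_on_compose_field:
  fixes q :: "real^'n::finite \<Rightarrow> 'a::real_normed_field"
  assumes U: "open U" and q: "\<And>k. k_diff_on k U q" and T: "\<And>x. x \<in> U \<Longrightarrow> q x \<in> T"
    and Z: "\<And>n t. t \<in> T \<Longrightarrow> (Z n has_field_derivative Z (Suc n) t) (at t)"
  shows "k_diff_on k U (\<lambda>x. Z n (q x))"
proof (induction k arbitrary: n)
  case (Suc k)
  have dq: "q differentiable at x" if "x \<in> U" for x
    using q[of "Suc 0"] that by simp
  have "(\<lambda>x. Z n (q x)) differentiable at x" if "x \<in> U" for x
    using has_derivative_compose[OF has_derivative_frechet[OF dq[OF that]]]
      Z[OF T[OF that], of n] by (auto simp: has_field_derivative_def differentiable_def)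
  moreover have "k_diff_on k U (partial i (\<lambda>x. Z n (q x)))" for i
  proof -
    have "partial i (\<lambda>x. Z n (q x)) x = Z (Suc n) (q x) * partial i q x" if "x \<in> U" for x
      by (rule partial_compose_field[OF Z[OF T[OF that]] dq[OF that]])
    moreover have "k_diff_on k U (\<lambda>x. Z (Suc n) (q x) * partial i q x)"
      using q[of "Suc k"] by (intro k_diff_on_mult[OF U] Suc.IH) auto
    ultimately show ?thesis
      by (subst k_diff_on_cong[OF U]) auto
  qed
  ultimately show ?case by simp
qed simp

lemma has_derivative_of_real_compose:
  fixes f :: "real^'n::finite \<Rightarrow> real"
  assumes "f differentiable at x"
  shows "((\<lambda>x. of_real (f x) :: 'a::real_normed_algebra_1) has_derivative
          (\<lambda>h. of_real (frechet_derivative f (at x) h))) (at x)"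
  using bounded_linear.has_derivative[OF bounded_linear_of_real has_derivative_frechet[OF assms]] .

lemma partial_of_real:
  assumes "f differentiable at x"
  shows "partial i (\<lambda>x. of_real (f x) :: 'a::real_normed_algebra_1) x = of_real (partial i f x)"
  using partial_eq[OF has_derivative_of_real_compose[OF assms]] by (simp add: partial_def)

lemma k_diff_on_of_real:
  assumes "open U" "k_diff_on k U f"
  shows "k_diff_on k U (\<lambda>x. of_real (f x) :: 'a::real_normed_algebra_1)"
  using assms(2)
proof (induction k arbitrary: f)
  case (Suc k)
  have "k_diff_on k U (partial i (\<lambda>x. of_real (f x) :: 'a))" for i
    by (subst k_diff_on_cong[OF assms(1) partial_of_real]) (use Suc in auto)
  moreover have "(\<lambda>x. of_real (f x) :: 'a) differentiable at x" if "x \<in> U" for x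
    using has_derivative_of_real_compose[of f x] Suc.prems that
    by (auto simp: differentiable_def)
  ultimately show ?case by simp
qed simp

lemma has_derivative_dist_square:
  "((\<lambda>y::real^'n::finite. (x - y) \<bullet> (x - y)) has_derivative (\<lambda>h. - 2 * ((x - y) \<bullet> h))) (at y)"
  by (auto intro!: derivative_eq_intros simp: inner_commute)

lemma partial_dist_square:
  "partial i (\<lambda>y::real^'n::finite. (x - y) \<bullet> (x - y)) = (\<lambda>y. - 2 * ((x - y) $ i))"
  by (rule ext, subst partial_eq[OF has_derivative_dist_square]) (simp add: inner_axis)

lemma has_derivative_coord:
  "((\<lambda>y::real^'n::finite. c * ((x - y) $ i)) has_derivative (\<lambda>h. - c * h $ i)) (at y)"
  by (auto intro!: derivative_eq_intros bounded_linear.has_derivative[OF bounded_linear_vec_nth])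

lemma k_diff_on_dist_square:
  "k_diff_on k U (\<lambda>y::real^'n::finite. (x - y) \<bullet> (x - y))"
proof (cases k)
  case (Suc l)
  have "k_diff_on l U (\<lambda>y. - 2 * ((x - y) $ i))" for i
  proof (cases l)
    case (Suc m)
    have "partial j (\<lambda>y. - 2 * ((x - y) $ i)) = (\<lambda>y. 2 * axis j 1 $ i)" for j
      by (rule ext, subst partial_eq[OF has_derivative_coord]) simp
    then show ?thesis
      using Suc has_derivative_coord[of "-2" x i] by (auto simp: differentiable_def)
  qed simp
  then show ?thesis
    using Suc has_derivative_dist_square[of x]
    by (auto simp: differentiable_def partial_dist_square)
qed simp

section \<open>Smooth cutoff functions\<close>

text \<open>
  The \<open>n\<close>-th derivative of the flat function \<open>exp (- 1 / t)\<close>, extended by \<open>0\<close> to \<open>t \<le> 0\<close>: each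
  differentiation turns \<open>p (1 / t) exp (- 1 / t)\<close> into \<open>(1 / t)\<^sup>2 (p - p') (1 / t) exp (- 1 / t)\<close>.
\<close>

definition flat_deriv :: "nat \<Rightarrow> real \<Rightarrow> real" where
  "flat_deriv n t =
     (if t > 0 then poly (((\<lambda>p. [:0, 0, 1:] * (p - pderiv p)) ^^ n) 1) (1 / t) * exp (- 1 / t) else 0)"

text \<open>
  The exponential decay beats every power of \<open>1 / t\<close>; this makes all difference quotients at \<open>0\<close> converge to \<open>0\<close>.
\<close>

lemma tendsto_poly_exp_flat:
  fixes p :: "real poly"
  shows "((\<lambda>t. if t > 0 then poly p (1 / t) * exp (- 1 / t) else 0) \<longlongrightarrow> 0) (at 0)"
proof -
  have "((\<lambda>s. \<Sum>i\<le>degree p. coeff p i * (s ^ i / exp s)) \<longlongrightarrow> (\<Sum>i\<le>degree p. coeff p i * 0)) at_top"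
    by (intro tendsto_intros tendsto_power_div_exp_0)
  also have "(\<lambda>s. \<Sum>i\<le>degree p. coeff p i * (s ^ i / exp s)) = (\<lambda>s. poly p s * exp (- s))"
    by (simp add: poly_altdef exp_minus sum_distrib_right divide_inverse mult.assoc)
  finally have "((\<lambda>s. poly p s * exp (- s)) \<longlongrightarrow> 0) at_top" by simp
  from filterlim_compose[OF this filterlim_inverse_at_top_right]
  have right: "((\<lambda>t. poly p (inverse t) * exp (- inverse t)) \<longlongrightarrow> 0) (at_right 0)" .
  show ?thesis
  proof (rule filterlim_split_at)
    show "((\<lambda>t. if t > 0 then poly p (1 / t) * exp (- 1 / t) else 0) \<longlongrightarrow> 0) (at_right 0)"
      by (rule Lim_transform_eventually[OF right])
         (auto simp: eventually_at_filter inverse_eq_divide)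
    show "((\<lambda>t. if t > 0 then poly p (1 / t) * exp (- 1 / t) else 0) \<longlongrightarrow> 0) (at_left 0)"
      by (rule Lim_transform_eventually[OF tendsto_const]) (auto simp: eventually_at_filter)
  qed
qed

lemma has_field_derivative_flat_deriv:
  "(flat_deriv n has_field_derivative flat_deriv (Suc n) t) (at t)"
proof -
  define p where "p = ((\<lambda>p::real poly. [:0, 0, 1:] * (p - pderiv p)) ^^ n) 1"
  have fd: "flat_deriv n = (\<lambda>t. if t > 0 then poly p (1 / t) * exp (- 1 / t) else 0)"
    by (rule ext) (simp add: flat_deriv_def p_def)
  have fd': "flat_deriv (Suc n) =
      (\<lambda>t. if t > 0 then (1 / t)\<^sup>2 * (poly p (1 / t) - poly (pderiv p) (1 / t)) * exp (- 1 / t) else 0)"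
    by (rule ext) (simp add: flat_deriv_def p_def power2_eq_square)
  consider "t > 0" | "t < 0" | "t = 0" by linarith
  then show ?thesis
  proof cases
    case 1
    have "((\<lambda>t. poly p (1 / t) * exp (- 1 / t)) has_field_derivative flat_deriv (Suc n) t) (at t)"
      unfolding fd' using 1
      by (auto intro!: derivative_eq_intros simp: power2_eq_square field_simps)
    then show ?thesis
      by (rule has_field_derivative_transform_within_open[where S="{0<..}"]) (use 1 fd in auto)
  next
    case 2
    have "((\<lambda>t. 0) has_field_derivative flat_deriv (Suc n) t) (at t)"
      unfolding fd' using 2 by auto
    then show ?thesis
      by (rule has_field_derivative_transform_within_open[where S="{..<0}"]) (use 2 fd in auto)
  next
    case 3
    have "((\<lambda>t. if t > 0 then poly (pCons 0 p) (1 / t) * exp (- 1 / t) else 0) \<longlongrightarrow> 0) (at 0)"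
      by (rule tendsto_poly_exp_flat)
    then have "((\<lambda>t. flat_deriv n t / t) \<longlongrightarrow> 0) (at 0)"
      by (rule Lim_transform_eventually) (auto simp: fd eventually_at_filter)
    then show ?thesis
      using 3 by (simp add: has_field_derivative_iff fd fd')
  qed
qed

lemma flat_le_one: "0 \<le> flat_deriv 0 t" "flat_deriv 0 t \<le> 1"
  by (auto simp: flat_deriv_def)

lemma flat_mono: "s \<le> t \<Longrightarrow> flat_deriv 0 s \<le> flat_deriv 0 t"
  by (auto simp: flat_deriv_def frac_le)

text \<open>
  With the flat function \<open>f\<close>, the cutoff is \<open>e f(1 - f(|y|\<^sup>2 - a\<^sup>2) / f(b\<^sup>2 - a\<^sup>2))\<close>. The inner \<open>f\<close>
  vanishes for \<open>|y| \<le> a\<close>, where the value is \<open>e f(1) = 1\<close>; for \<open>|y| \<ge> b\<close> the quotient is at least \<open>1\<close>,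
  so the argument of the outer \<open>f\<close> is not positive. Being a composition of \<open>f\<close> with a polynomial and with
  itself, it is smooth everywhere.
\<close>

lemma smooth_cutoff_exists:
  assumes "0 < a" "a < b"
  obtains \<eta> :: "real^'n::finite \<Rightarrow> real"
  where "\<And>k. k_diff_on k UNIV \<eta>" "\<And>y. 0 \<le> \<eta> y" "\<And>y. \<eta> y \<le> 1"
    "\<And>y. norm y \<le> a \<Longrightarrow> \<eta> y = 1" "\<And>y. b \<le> norm y \<Longrightarrow> \<eta> y = 0"
proof -
  define f where "f = flat_deriv 0"
  define c where "c = f (b\<^sup>2 - a\<^sup>2)"
  have ab: "a\<^sup>2 < b\<^sup>2" using assms by (simp add: power_strict_mono)
  have c: "c > 0" using ab by (simp add: c_def f_def flat_deriv_def)
  define q where "q = (\<lambda>y::real^'n. (0 - y) \<bullet> (0 - y))"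
  have q: "q y = (norm y)\<^sup>2" for y by (simp add: q_def power2_norm_eq_inner)
  define \<eta> where "\<eta> = (\<lambda>y. exp 1 * f (1 + (- 1 / c) * f (q y + - a\<^sup>2)))"
  have f_comp: "\<And>k. k_diff_on k UNIV (\<lambda>y. f (g y))" if "\<And>k. k_diff_on k UNIV g"
    for g :: "real^'n \<Rightarrow> real"
    unfolding f_def
    by (rule k_diff_on_compose_field[where T=UNIV]) (auto intro: has_field_derivative_flat_deriv that)
  show thesis
  proof (rule that[of \<eta>])
    show "k_diff_on k UNIV \<eta>" for k
      unfolding \<eta>_def q_def
      by (intro k_diff_on_mult k_diff_on_add f_comp k_diff_on_dist_square k_diff_on_const) auto
    have f1: "f t * exp 1 \<le> 1" if "t \<le> 1" for t
    proof -
      have "f t \<le> exp (-1)" using flat_mono[OF that] by (simp add: f_def flat_deriv_def)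
      then show ?thesis by (simp add: exp_minus field_simps)
    qed
    show "0 \<le> \<eta> y" for y using flat_le_one by (simp add: \<eta>_def f_def)
    show "\<eta> y \<le> 1" for y
      using f1[of "1 + (- 1 / c) * f (q y + - a\<^sup>2)"] flat_le_one(1)[of "q y + - a\<^sup>2"] c
      by (simp add: \<eta>_def f_def mult.commute)
    show "\<eta> y = 1" if "norm y \<le> a" for y
    proof -
      have "q y \<le> a\<^sup>2" unfolding q using that by (simp add: power_mono)
      then show ?thesis by (simp add: \<eta>_def f_def flat_deriv_def flip: exp_add)
    qed
    show "\<eta> y = 0" if "b \<le> norm y" for y
    proof -
      have "b\<^sup>2 \<le> q y" unfolding q using that assms by (simp add: power_mono)
      then have "c \<le> f (q y + - a\<^sup>2)" using flat_mono by (simp add: c_def f_def)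
      then have "1 + (- 1 / c) * f (q y + - a\<^sup>2) \<le> 0" using c by (simp add: field_simps)
      then show ?thesis by (simp add: \<eta>_def f_def flat_deriv_def)
    qed
  qed
qed

section \<open>The scalar Green function and its Hessian\<close>

text \<open>
  The Green function as a holomorphic function of the squared distance on the slit plane. Its
  derivatives of all orders then come from complex analysis, and those of the squared distance are trivial.
\<close>

definition green_profile :: "real \<Rightarrow> complex \<Rightarrow> complex" where
  "green_profile \<kappa> z = exp (\<i> * complex_of_real \<kappa> * csqrt z) / (complex_of_real (4 * pi) * csqrt z)"

lemma holomorphic_green_profile: "green_profile \<kappa> holomorphic_on (- \<real>\<^sub>\<le>\<^sub>0)"
  unfolding green_profile_def by (intro holomorphic_intros) auto

lemma open_slit_plane: "open (- \<real>\<^sub>\<le>\<^sub>0 :: complex set)"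
  by (simp add: open_Compl)

lemma has_field_derivative_green_profile:
  assumes "z \<notin> \<real>\<^sub>\<le>\<^sub>0"
  shows "((deriv ^^ n) (green_profile \<kappa>) has_field_derivative (deriv ^^ Suc n) (green_profile \<kappa>) z) (at z)"
proof -
  have "(deriv ^^ n) (green_profile \<kappa>) holomorphic_on - \<real>\<^sub>\<le>\<^sub>0"
    by (rule holomorphic_higher_deriv[OF holomorphic_green_profile open_slit_plane])
  from holomorphic_derivI[OF this open_slit_plane] assms show ?thesis by simp
qed

lemma green_eq_profile:
  "green \<kappa> x y = green_profile \<kappa> (complex_of_real ((x - y) \<bullet> (x - y)))"
proof -
  have "csqrt (complex_of_real ((x - y) \<bullet> (x - y))) = complex_of_real (norm (x - y))"
    by (subst of_real_sqrt [symmetric]) (simp_all add: norm_eq_sqrt_inner)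
  then show ?thesis
    unfolding green_def green_profile_def by (simp only: of_real_mult mult.assoc)
qed

lemma dist_square_slit: "x \<noteq> y \<Longrightarrow> complex_of_real ((x - y) \<bullet> (x - y)) \<notin> \<real>\<^sub>\<le>\<^sub>0"
  by (simp add: complex_nonpos_Reals_iff not_le)

lemma k_diff_on_green_profile:
  fixes x :: "real^'n::finite"
  assumes "open U" "x \<notin> U"
  shows "k_diff_on k U (\<lambda>y. (deriv ^^ n) (green_profile \<kappa>) (complex_of_real ((x - y) \<bullet> (x - y))))"
proof (rule k_diff_on_compose_field[where T="- \<real>\<^sub>\<le>\<^sub>0" and Z="\<lambda>n. (deriv ^^ n) (green_profile \<kappa>)"
      and q="\<lambda>y. complex_of_real ((x - y) \<bullet> (x - y))"])
  show "k_diff_on l U (\<lambda>y. complex_of_real ((x - y) \<bullet> (x - y)))" for l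
    by (intro k_diff_on_of_real k_diff_on_dist_square assms)
  show "complex_of_real ((x - y) \<bullet> (x - y)) \<in> - \<real>\<^sub>\<le>\<^sub>0" if "y \<in> U" for y
    using that assms dist_square_slit[of x y] by auto
next
  fix m and t :: complex assume "t \<in> - \<real>\<^sub>\<le>\<^sub>0"
  then have "t \<notin> \<real>\<^sub>\<le>\<^sub>0" by simp
  then show "((deriv ^^ m) (green_profile \<kappa>) has_field_derivative
      (deriv ^^ Suc m) (green_profile \<kappa>) t) (at t)"
    by (rule has_field_derivative_green_profile)
qed (rule assms(1))

lemma k_diff_on_green:
  assumes "open U" "x \<notin> U"
  shows "k_diff_on k U (green \<kappa> x)"
proof -
  have "green \<kappa> x = (\<lambda>y. (deriv ^^ 0) (green_profile \<kappa>) (complex_of_real ((x - y) \<bullet> (x - y))))"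
    by (rule ext) (simp only: green_eq_profile funpow_0)
  then show ?thesis using k_diff_on_green_profile[OF assms] by metis
qed

lemma differentiable_dist_square: "(\<lambda>y::real^'n::finite. (x - y) \<bullet> (x - y)) differentiable at y"
  by (rule differentiableI[OF has_derivative_dist_square])

lemma partial_green_profile:
  fixes x y :: "real^'n::finite"
  assumes "x \<noteq> y"
  shows "partial j (\<lambda>y. (deriv ^^ n) (green_profile \<kappa>) (complex_of_real ((x - y) \<bullet> (x - y)))) y =
     - 2 * (deriv ^^ Suc n) (green_profile \<kappa>) (complex_of_real ((x - y) \<bullet> (x - y)))
       * complex_of_real ((x - y) $ j)"
proof -
  have "(\<lambda>y. complex_of_real ((x - y) \<bullet> (x - y))) differentiable at y"
    by (rule differentiableI[OF has_derivative_of_real_compose[OF differentiable_dist_square]])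
  note * = partial_compose_field[OF has_field_derivative_green_profile[OF dist_square_slit[OF assms]] this]
  show ?thesis
    unfolding * partial_of_real[OF differentiable_dist_square] partial_dist_square
    by (simp only: of_real_mult of_real_minus of_real_numeral mult_ac)
qed

text \<open>
  The formula is symmetric in \<open>i, j\<close> and in \<open>x, y\<close>. The first symmetry reconciles the order of
  differentiation in the tensor with that of the distributional gradient of a divergence, the second
  allows the Hessian to be taken in the variable of integration.
\<close>

lemma green_hessian:
  fixes x y :: "real^3"
  assumes "x \<noteq> y"
  shows "partial i (partial j (green \<kappa> x)) y =
     4 * (deriv ^^ 2) (green_profile \<kappa>) (complex_of_real ((x - y) \<bullet> (x - y)))
         * complex_of_real ((x - y) $ i) * complex_of_real ((x - y) $ j)
     + (if i = j then 2 * deriv (green_profile \<kappa>) (complex_of_real ((x - y) \<bullet> (x - y))) else 0)"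
proof -
  let ?D = "\<lambda>n y. (deriv ^^ n) (green_profile \<kappa>) (complex_of_real ((x - y) \<bullet> (x - y)))"
  have g: "green \<kappa> x = ?D 0" by (rule ext) (simp only: green_eq_profile funpow_0)
  have dD: "?D (Suc 0) differentiable at y"
    using k_diff_on_green_profile[of "- {x}" x "Suc 0" "Suc 0" \<kappa>] assms
    by (simp add: open_Compl)
  have c: "((\<lambda>y. -2 * complex_of_real ((x - y) $ j)) has_derivative (\<lambda>h. 2 * complex_of_real (h $ j))) (at y)"
    by (auto intro!: derivative_eq_intros bounded_linear.has_derivative[OF bounded_linear_vec_nth])
  have "partial i (partial j (green \<kappa> x)) y
      = partial i (\<lambda>y. ?D (Suc 0) y * (-2 * complex_of_real ((x - y) $ j))) y"
    unfolding g
  proof (rule partial_cong_open[where U="- {x}"])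
    show "partial j (?D 0) w = ?D (Suc 0) w * (-2 * complex_of_real ((x - w) $ j))"
      if "w \<in> - {x}" for w
      using partial_green_profile[of x w j 0 \<kappa>] that by (simp only: mult_ac) blast
  qed (use assms in \<open>auto simp: open_Compl\<close>)
  also have "\<dots> = ?D (Suc 0) y * (2 * complex_of_real (axis i 1 $ j))
      + partial i (?D (Suc 0)) y * (-2 * complex_of_real ((x - y) $ j))"
    by (subst partial_mult[OF dD]) (use partial_eq[OF c] c in \<open>auto simp: differentiable_def\<close>)
  finally show ?thesis
    by (subst (asm) partial_green_profile[OF assms]) (auto simp: axis_def numeral_2_eq_2 simp del: vector_minus_component)
qed

lemma green_hessian_symmetric:
  assumes "x \<noteq> y"
  shows "partial i (partial j (green \<kappa> x)) y = partial j (partial i (green \<kappa> x)) y"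
  by (simp add: green_hessian[OF assms] mult_ac)

lemma green_hessian_swap:
  assumes "x \<noteq> y"
  shows "partial i (partial j (\<lambda>z. green \<kappa> z y)) x = partial i (partial j (green \<kappa> x)) y"
proof -
  have dsq: "(y - x) \<bullet> (y - x) = (x - y) \<bullet> (x - y)"
    by (metis inner_minus_left inner_minus_right minus_diff_eq minus_minus)
  have c: "complex_of_real ((y - x) $ k) = - complex_of_real ((x - y) $ k)" for k by simp
  have "(\<lambda>z. green \<kappa> z y) = green \<kappa> y"
    by (simp add: fun_eq_iff green_def norm_minus_commute)
  then show ?thesis
    using green_hessian[OF assms, of i j \<kappa>] green_hessian[OF assms[symmetric], of i j \<kappa>]
    by (simp only: dsq c minus_mult_minus mult.assoc mult_minus_left mult_minus_right minus_minus)
qed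

section \<open>Moving the Hessian to the source\<close>

text \<open>
  The complement of the essential support is an uncountable union of open sets on which \<open>f\<close> vanishes
  almost everywhere; by the Lindelof property countably many of them suffice.
\<close>

lemma AE_zero_off_ess_support:
  assumes "open \<Omega>"
  shows "AE x in lebesgue_on \<Omega>. x \<notin> ess_support \<Omega> f \<longrightarrow> f x = 0"
proof -
  define \<F> where "\<F> = {U. open U \<and> U \<subseteq> \<Omega> \<and> (AE x in lebesgue_on U. f x = 0)}"
  obtain \<G> where \<G>: "\<G> \<subseteq> \<F>" "countable \<G>" "\<Union>\<G> = \<Union>\<F>"
    using Lindelof[of \<F>] by (auto simp: \<F>_def)
  have "AE x in lebesgue. x \<in> U \<longrightarrow> f x = 0" if "U \<in> \<G>" for U
    using that \<G>(1) by (subst AE_restrict_space_iff[symmetric]) (auto simp: \<F>_def)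
  then have "AE x in lebesgue. \<forall>U\<in>\<G>. x \<in> U \<longrightarrow> f x = 0"
    by (simp only: AE_ball_countable[OF \<G>(2)]) blast
  moreover have "ess_support \<Omega> f = \<Omega> - \<Union>\<G>"
    using \<G>(3) by (simp add: ess_support_def \<F>_def)
  ultimately have "AE x in lebesgue. x \<in> \<Omega> \<longrightarrow> (x \<notin> ess_support \<Omega> f \<longrightarrow> f x = 0)"
    by (auto elim!: AE_mp)
  then show ?thesis
    using assms by (subst AE_restrict_space_iff) auto
qed

lemma compact_subset_smaller_ball:
  assumes "compact (K :: 'a::euclidean_space set)" "K \<subseteq> ball 0 R" "R > 0"
  obtains r where "0 < r" "r < R" "K \<subseteq> ball 0 r"
proof (cases "K = {}")
  case False
  obtain z where z: "z \<in> K" "\<forall>y\<in>K. norm y \<le> norm z"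
    using continuous_attains_sup[OF assms(1) False, of norm] by (auto intro: continuous_intros)
  have "norm z < R" using z assms(2) by auto
  show thesis
    by (rule that[of "(norm z + R) / 2"])
       (use z assms(3) \<open>norm z < R\<close> in \<open>auto intro: le_less_trans add_nonneg_pos\<close>)
next
  case True
  then show thesis using that[of "R/2"] assms(3) by simp
qed

lemma integrable_mult_bounded:
  fixes f h :: "'a \<Rightarrow> complex"
  assumes "integrable M f" "h \<in> borel_measurable M" "\<And>x. x \<in> space M \<Longrightarrow> norm (h x) \<le> C"
  shows "integrable M (\<lambda>x. f x * h x)"
proof (rule Bochner_Integration.integrable_bound)
  show "integrable M (\<lambda>x. C * norm (f x))"
    using assms(1) by simp
  show "(\<lambda>x. f x * h x) \<in> borel_measurable M"
    using assms by measurable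
  show "AE x in M. norm (f x * h x) \<le> norm (C * norm (f x))"
  proof (rule AE_I2)
    fix x assume x: "x \<in> space M"
    have "norm (f x * h x) \<le> C * norm (f x)"
      using mult_left_mono[OF assms(3)[OF x], of "norm (f x)"] by (simp add: norm_mult mult.commute)
    then show "norm (f x * h x) \<le> norm (C * norm (f x))" by (simp add: abs_if)
  qed
qed

lemma L2_on_component_integrable:
  fixes J :: "real^'n::finite \<Rightarrow> complex^'m::finite"
  assumes "J \<in> L2_on \<Omega>" "\<Omega> \<in> lmeasurable"
  shows "integrable (lebesgue_on \<Omega>) (\<lambda>y. J y $ i)"
proof (rule Bochner_Integration.integrable_bound)
  have fin: "finite_measure (lebesgue_on \<Omega>)"
    using assms(2) by (simp add: finite_measure_lebesgue_on)
  show "integrable (lebesgue_on \<Omega>) (\<lambda>y. 1 + (norm (J y))\<^sup>2)"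
    using assms(1) by (intro Bochner_Integration.integrable_add finite_measure.integrable_const[OF fin])
      (auto simp: L2_on_def)
  show "(\<lambda>y. J y $ i) \<in> borel_measurable (lebesgue_on \<Omega>)"
    using assms(1) by (intro borel_measurable_continuous_on[where f="\<lambda>v. v $ i"] continuous_intros)
      (auto simp: L2_on_def)
  show "AE y in lebesgue_on \<Omega>. norm (J y $ i) \<le> norm (1 + (norm (J y))\<^sup>2)"
  proof (rule AE_I2)
    fix y
    have "0 \<le> (norm (J y) - 1)\<^sup>2" by simp
    then have "2 * norm (J y) \<le> 1 + (norm (J y))\<^sup>2" by (simp add: power2_diff)
    moreover have "norm (J y $ i) \<le> norm (J y)" by (rule Finite_Cartesian_Product.norm_nth_le)
    ultimately have "norm (J y $ i) \<le> 1 + (norm (J y))\<^sup>2"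
      using norm_ge_zero[of "J y"] by linarith
    then show "norm (J y $ i) \<le> norm (1 + (norm (J y))\<^sup>2)" by simp
  qed
qed

text \<open>
  The pole \<open>x\<close> lies where the cutoff is \<open>0\<close>: the product is smooth off \<open>x\<close>, vanishes identically on
  \<open>{y. b < |y|}\<close>, and these two open sets cover the space.
\<close>

lemma green_cutoff_test_function:
  fixes \<eta> :: "real^3 \<Rightarrow> real" and \<kappa> :: real and x :: "real^3"
  assumes \<eta>: "\<And>k. k_diff_on k UNIV \<eta>" "\<And>y. b \<le> norm y \<Longrightarrow> \<eta> y = 0" and "b < norm x" "b < R"
  defines "\<phi> \<equiv> \<lambda>y. complex_of_real (\<eta> y) * green \<kappa> x y"
  shows "k_diff_on k UNIV \<phi>" "\<phi> \<in> test_functions (ball 0 R)"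
proof -
  have sm: "k_diff_on k UNIV \<phi>" for k
  proof -
    have o: "open {y::real^3. b < norm y}" by (simp add: open_Collect_less continuous_intros)
    have "k_diff_on k (- {x}) \<phi>"
      unfolding \<phi>_def using \<eta>(1)
      by (intro k_diff_on_mult k_diff_on_of_real k_diff_on_green)
         (auto intro: k_diff_on_subset simp: open_Compl)
    moreover have "k_diff_on k {y. b < norm y} \<phi>"
      using k_diff_on_cong[OF o, of \<phi> "\<lambda>y. 0" k] \<eta>(2) by (simp add: \<phi>_def)
    ultimately have "k_diff_on k (- {x} \<union> {y. b < norm y}) \<phi>" by (rule k_diff_on_Un)
    moreover have "- {x} \<union> {y. b < norm y} = UNIV" using assms(3) by auto
    ultimately show ?thesis by simp
  qed
  then show "k_diff_on k UNIV \<phi>" .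
  have "closure {y. \<phi> y \<noteq> 0} \<subseteq> cball 0 b"
    by (rule closure_minimal) (use \<eta>(2) in \<open>force simp: \<phi>_def not_le[symmetric]\<close>)+
  moreover from this have "compact (closure {y. \<phi> y \<noteq> 0})"
    using bounded_subset[OF bounded_cball] by (simp add: compact_eq_bounded_closed)
  ultimately show "\<phi> \<in> test_functions (ball 0 R)"
    using sm assms(4) by (auto simp: test_functions_def smooth_iff)
qed

lemma k_diff_on_imp_continuous:
  "k_diff_on (Suc k) U f \<Longrightarrow> continuous_on U f"
  by (auto intro!: continuous_at_imp_continuous_on differentiable_imp_continuous_within)

lemma lebesgue_on_ball_measurable:
  "continuous_on (ball 0 R) h \<Longrightarrow> h \<in> borel_measurable (lebesgue_on (ball 0 R :: (real^3) set))"
  by (rule continuous_imp_measurable_on_sets_lebesgue) auto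

text \<open>
  Testing the definition of \<open>W = grad div J\<close> with a cut-off Green function. Where \<open>J\<close> does not vanish the
  cutoff is locally constant \<open>1\<close>, so it disappears from the side of \<open>J\<close>, though it stays on the side of \<open>W\<close>.
\<close>

lemma weak_grad_div_green:
  fixes J W :: "real^3 \<Rightarrow> complex^3" and \<eta> :: "real^3 \<Rightarrow> real"
  assumes W: "has_grad_div (ball 0 R) J W" and J: "J \<in> L2_on (ball 0 R)"
    and J0: "AE y in lebesgue_on (ball 0 R). r \<le> norm y \<longrightarrow> J y = 0"
    and \<eta>: "\<And>k. k_diff_on k UNIV \<eta>" "\<And>y. norm y \<le> r \<Longrightarrow> \<eta> y = 1" "\<And>y. b \<le> norm y \<Longrightarrow> \<eta> y = 0"
    and "b < R" "R \<le> norm x"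
  shows "\<And>j. integrable (lebesgue_on (ball 0 R)) (\<lambda>y. J y $ j * partial i (partial j (green \<kappa> x)) y)"
    and "(\<Sum>j\<in>UNIV. LINT y|lebesgue_on (ball 0 R). J y $ j * partial i (partial j (green \<kappa> x)) y)
       = (LINT y|lebesgue_on (ball 0 R). W y $ i * (complex_of_real (\<eta> y) * green \<kappa> x y))"
proof -
  let ?M = "lebesgue_on (ball 0 R :: (real^3) set)"
  define \<phi> where "\<phi> = (\<lambda>y. complex_of_real (\<eta> y) * green \<kappa> x y)"
  note \<phi> = green_cutoff_test_function[where \<eta>=\<eta> and b=b and x=x and R=R and \<kappa>=\<kappa>, folded \<phi>_def]
  have smooth: "k_diff_on k UNIV \<phi>" for k by (rule \<phi>(1)) (use assms in auto)
  have test: "\<phi> \<in> test_functions (ball 0 R)" by (rule \<phi>(2)) (use assms in auto)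
  have Jint: "integrable ?M (\<lambda>y. J y $ j)" for j
    by (rule L2_on_component_integrable[OF J]) auto
  have int1: "integrable ?M (\<lambda>y. J y $ j * partial j (partial i \<phi>) y)" for j
  proof -
    have "k_diff_on (Suc 0) UNIV (partial j (partial i \<phi>))"
      using smooth[of "Suc (Suc (Suc 0))"] by (simp del: k_diff_on.simps(1))
    then have c: "continuous_on UNIV (partial j (partial i \<phi>))" by (rule k_diff_on_imp_continuous)
    have "compact (partial j (partial i \<phi>) ` cball 0 R)"
      by (rule compact_continuous_image[OF continuous_on_subset[OF c]]) auto
    then obtain C where C: "norm z \<le> C" if "z \<in> partial j (partial i \<phi>) ` cball 0 R" for z
      using compact_imp_bounded bounded_iff by metis
    show ?thesis
    proof (rule integrable_mult_bounded[OF Jint, where C=C])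
      show "partial j (partial i \<phi>) \<in> borel_measurable ?M"
        by (rule lebesgue_on_ball_measurable[OF continuous_on_subset[OF c]]) simp
    qed (use C in auto)
  qed
  have meas2: "(\<lambda>y. J y $ j * partial i (partial j (green \<kappa> x)) y) \<in> borel_measurable ?M" for j
  proof -
    have "k_diff_on (Suc 0) (ball 0 R) (partial i (partial j (green \<kappa> x)))"
      using k_diff_on_green[of "ball 0 R" x "Suc (Suc (Suc 0))" \<kappa>] assms
      by (simp del: k_diff_on.simps(1))
    then have "partial i (partial j (green \<kappa> x)) \<in> borel_measurable ?M"
      by (intro lebesgue_on_ball_measurable k_diff_on_imp_continuous)
    with Jint[of j] show ?thesis by measurable
  qed
  have near: "partial j (partial i \<phi>) y = partial i (partial j (green \<kappa> x)) y"
    if "norm y < r" "y \<in> ball 0 R" for j y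
  proof -
    have first: "partial i \<phi> z = partial i (green \<kappa> x) z" if "z \<in> ball 0 r" for z
      by (rule partial_cong_open[of "ball 0 r"]) (use that \<eta>(2) in \<open>auto simp: \<phi>_def\<close>)
    have "partial j (partial i \<phi>) y = partial j (partial i (green \<kappa> x)) y"
      by (rule partial_cong_open[of "ball 0 r"]) (use that first in auto)
    moreover have "x \<noteq> y" using that assms by auto
    ultimately show ?thesis by (simp add: green_hessian_symmetric)
  qed
  have eq: "AE y in ?M. J y $ j * partial j (partial i \<phi>) y = J y $ j * partial i (partial j (green \<kappa> x)) y" for j
    using J0 by (rule AE_mp) (auto intro!: AE_I2 simp: near not_le)
  show int2: "\<And>j. integrable ?M (\<lambda>y. J y $ j * partial i (partial j (green \<kappa> x)) y)"
    using integrable_cong_AE[OF _ meas2 eq] int1 by auto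
  have "(\<Sum>j\<in>UNIV. LINT y|?M. J y $ j * partial i (partial j (green \<kappa> x)) y)
      = (\<Sum>j\<in>UNIV. LINT y|?M. J y $ j * partial j (partial i \<phi>) y)"
    using int1 by (intro sum.cong refl integral_cong_AE[symmetric] meas2 eq) auto
  also have "\<dots> = dist_partial i (dist_div (ball 0 R) J) \<phi>"
    by (simp add: dist_partial_def dist_div_def dist_of_fun_def sum_negf)
  also have "\<dots> = (LINT y|?M. W y $ i * \<phi> y)"
    using W test by (simp add: has_grad_div_def dist_of_fun_def)
  finally show "(\<Sum>j\<in>UNIV. LINT y|?M. J y $ j * partial i (partial j (green \<kappa> x)) y)
       = (LINT y|?M. W y $ i * (complex_of_real (\<eta> y) * green \<kappa> x y))"
    by (simp add: \<phi>_def)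
qed

lemma integral_vec_nth:
  fixes v :: "'a \<Rightarrow> complex^'m::finite"
  assumes "\<And>i. integrable M (\<lambda>y. v y $ i)"
  shows "integral\<^sup>L M v $ i = (LINT y|M. v y $ i)"
proof -
  have bl: "bounded_linear (axis j :: complex \<Rightarrow> complex^'m)" for j
  proof (rule bounded_linear_intro[where K=1])
    fix x :: complex
    have "(\<Sum>i\<in>UNIV. (norm ((axis j x :: complex^'m) $ i))\<^sup>2) = (\<Sum>i\<in>UNIV. if i = j then (norm x)\<^sup>2 else 0)"
      by (intro sum.cong) (auto simp: axis_def)
    then show "norm (axis j x :: complex^'m) \<le> norm x * 1"
      by (simp add: norm_vec_def L2_set_def)
  qed (auto simp: axis_def vec_eq_iff)
  have "v = (\<lambda>y. \<Sum>j\<in>UNIV. axis j (v y $ j))"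
    by (auto simp: vec_eq_iff axis_def)
  moreover have "integrable M (\<lambda>y. \<Sum>j\<in>UNIV. axis j (v y $ j))"
    using assms by (intro Bochner_Integration.integrable_sum integrable_bounded_linear[OF bl])
  ultimately have "integrable M v" by simp
  from integral_bounded_linear[OF bounded_linear_vec_nth this] show ?thesis by simp
qed

text \<open>
  The potential of a scalar density: outgoing for \<open>\<kappa> > 0\<close> and incoming for \<open>\<kappa> < 0\<close>.
\<close>

definition radiated :: "real \<Rightarrow> real \<Rightarrow> (real^3 \<Rightarrow> complex) \<Rightarrow> real^3 \<Rightarrow> complex" where
  "radiated \<kappa> R f x = (LINT y|lebesgue_on (ball 0 R). green \<kappa> x y * f y)"

lemma spherical_bessel_green:
  assumes "\<kappa> > 0" "x \<noteq> y"
  shows "complex_of_real (spherical_bessel_j0 (\<kappa> * norm (x - y)))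
    = 2 * pi / (\<i> * \<kappa>) * (green \<kappa> x y - green (- \<kappa>) x y)"
proof -
  have 1: "exp (\<i> * complex_of_real t) - exp (\<i> * complex_of_real (- t)) = 2 * \<i> * sin t" for t
    by (simp add: complex_eq_iff Re_exp Im_exp)
  have "green \<kappa> x y - green (- \<kappa>) x y
      = 2 * \<i> * sin (\<kappa> * norm (x - y)) / complex_of_real (4 * pi * norm (x - y))"
    unfolding green_def diff_divide_distrib[symmetric]
    using 1[of "\<kappa> * norm (x - y)"] by simp
  then show ?thesis
    using assms by (simp add: spherical_bessel_j0_def field_simps)
qed

lemma norm_green: "norm (green \<kappa> x y) = 1 / (4 * pi * norm (x - y))"
proof -
  have "cmod (exp (\<i> * complex_of_real t)) = 1" for t by simp
  from this[of "\<kappa> * norm (x - y)"] show ?thesis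
    by (simp add: green_def norm_divide norm_mult del: of_real_mult)
qed

text \<open>
  A source vanishing outside the ball of radius \<open>r\<close>, its gradient of the divergence \<open>W\<close>, and a cutoff
  \<open>\<eta>\<close> that separates the support of the source from the sphere of radius \<open>R\<close>.
\<close>

locale truncated_source =
  fixes R r b :: real and J W :: "real^3 \<Rightarrow> complex^3" and \<eta> :: "real^3 \<Rightarrow> real"
  assumes r: "0 < r" and rb: "r < b" and bR: "b < R"
    and J_L2: "J \<in> L2_on (ball 0 R)"
    and grad_div: "has_grad_div (ball 0 R) J W"
    and J_vanishes: "AE y in lebesgue_on (ball 0 R). r \<le> norm y \<longrightarrow> J y = 0"
    and \<eta>_smooth: "\<And>k. k_diff_on k UNIV \<eta>"
    and \<eta>_one: "\<And>y. norm y \<le> r \<Longrightarrow> \<eta> y = 1"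
    and \<eta>_zero: "\<And>y. b \<le> norm y \<Longrightarrow> \<eta> y = 0"
begin

abbreviation "M \<equiv> lebesgue_on (ball 0 R :: (real^3) set)"

text \<open>
  The scalar densities whose potentials are the components of the field outside the
  ball. The cutoff makes
  them vanish for \<open>|y| \<ge> b\<close>, which gives their far fields a disc of holomorphy of radius \<open>1 / b > 1 / R\<close>.
\<close>

definition effective_source :: "real \<Rightarrow> 3 \<Rightarrow> real^3 \<Rightarrow> complex" where
  "effective_source \<kappa> i y = complex_of_real (\<eta> y) * (J y $ i + 1 / complex_of_real (\<kappa>\<^sup>2) * W y $ i)"

lemma J_int: "integrable M (\<lambda>y. J y $ i)"
  by (rule L2_on_component_integrable[OF J_L2]) auto

lemma W_int: "integrable M (\<lambda>y. W y $ i)"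
  using grad_div by (intro L2_on_component_integrable) (auto simp: has_grad_div_def)

lemma integrable_mult_continuous:
  fixes f :: "real^3 \<Rightarrow> complex"
  assumes "integrable M f" "continuous_on UNIV h"
  shows "integrable M (\<lambda>y. f y * h y)"
proof -
  have "compact (h ` cball 0 R)"
    by (rule compact_continuous_image[OF continuous_on_subset[OF assms(2)]]) auto
  then obtain C where C: "norm z \<le> C" if "z \<in> h ` cball 0 R" for z
    using compact_imp_bounded bounded_iff by metis
  show ?thesis
    by (rule integrable_mult_bounded[OF assms(1), where C=C])
       (use C in \<open>auto intro: lebesgue_on_ball_measurable continuous_on_subset[OF assms(2)]\<close>)
qed

lemma effective_source_integrable: "integrable M (effective_source \<kappa> i)"
proof -
  have "continuous_on UNIV \<eta>"
    using \<eta>_smooth k_diff_on_imp_continuous by blast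
  then have "integrable M (\<lambda>y. (J y $ i + 1 / complex_of_real (\<kappa>\<^sup>2) * W y $ i) * complex_of_real (\<eta> y))"
    by (intro integrable_mult_continuous Bochner_Integration.integrable_add J_int
        integrable_mult_right W_int continuous_intros)
  then show ?thesis by (simp add: effective_source_def[abs_def] mult.commute)
qed

lemma effective_source_zero: "b \<le> norm y \<Longrightarrow> effective_source \<kappa> i y = 0"
  by (simp add: effective_source_def \<eta>_zero)

lemma integrable_mult_cutoff_green:
  fixes f :: "real^3 \<Rightarrow> complex"
  assumes "R \<le> norm x" "integrable M f"
  shows "integrable M (\<lambda>y. f y * (complex_of_real (\<eta> y) * green \<kappa> x y))"
proof -
  have "k_diff_on (Suc 0) UNIV (\<lambda>y. complex_of_real (\<eta> y) * green \<kappa> x y)"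
    by (rule green_cutoff_test_function(1)[OF \<eta>_smooth \<eta>_zero]) (use assms(1) bR in auto)
  from integrable_mult_continuous[OF assms(2) k_diff_on_imp_continuous[OF this]] show ?thesis .
qed

lemma green_measurable: "R \<le> norm x \<Longrightarrow> green \<kappa> x \<in> borel_measurable M"
  by (intro lebesgue_on_ball_measurable k_diff_on_imp_continuous k_diff_on_green) auto

lemma J_green:
  assumes "R \<le> norm x"
  shows "integrable M (\<lambda>y. J y $ i * green \<kappa> x y)"
    and "(LINT y|M. J y $ i * green \<kappa> x y) = (LINT y|M. J y $ i * (complex_of_real (\<eta> y) * green \<kappa> x y))"
proof -
  have m: "(\<lambda>y. J y $ i * green \<kappa> x y) \<in> borel_measurable M"
    using J_int[of i] green_measurable[OF assms, of \<kappa>] by measurable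
  have i: "integrable M (\<lambda>y. J y $ i * (complex_of_real (\<eta> y) * green \<kappa> x y))"
    by (rule integrable_mult_cutoff_green[OF assms J_int])
  have e: "AE y in M. J y $ i * (complex_of_real (\<eta> y) * green \<kappa> x y) = J y $ i * green \<kappa> x y"
    using J_vanishes by (rule AE_mp) (auto intro!: AE_I2 simp: \<eta>_one not_le)
  show "integrable M (\<lambda>y. J y $ i * green \<kappa> x y)"
    using integrable_cong_AE[OF _ m e] i by auto
  show "(LINT y|M. J y $ i * green \<kappa> x y) = (LINT y|M. J y $ i * (complex_of_real (\<eta> y) * green \<kappa> x y))"
    using i by (intro integral_cong_AE[symmetric] m e) auto
qed

lemma radiated_effective_source:
  assumes "R \<le> norm x"
  shows "radiated \<sigma> R (effective_source \<kappa> i) x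
    = (LINT y|M. J y $ i * green \<sigma> x y)
      + 1 / complex_of_real (\<kappa>\<^sup>2) * (LINT y|M. W y $ i * (complex_of_real (\<eta> y) * green \<sigma> x y))"
proof -
  have "radiated \<sigma> R (effective_source \<kappa> i) x
     = (LINT y|M. J y $ i * (complex_of_real (\<eta> y) * green \<sigma> x y)
          + 1 / complex_of_real (\<kappa>\<^sup>2) * (W y $ i * (complex_of_real (\<eta> y) * green \<sigma> x y)))"
    unfolding radiated_def effective_source_def
    by (intro Bochner_Integration.integral_cong refl) (simp add: algebra_simps)
  also have "\<dots> = (LINT y|M. J y $ i * (complex_of_real (\<eta> y) * green \<sigma> x y))
          + 1 / complex_of_real (\<kappa>\<^sup>2) * (LINT y|M. W y $ i * (complex_of_real (\<eta> y) * green \<sigma> x y))"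
    by (subst Bochner_Integration.integral_add)
       (intro integrable_mult_cutoff_green assms J_int W_int integrable_mult_right | simp)+
  finally show ?thesis by (simp add: J_green(2)[OF assms])
qed

text \<open>
  In the Green tensor the Hessian acts on the point of observation; by symmetry it may act on the
  point of integration, and the weak identity moves it to the source as \<open>W\<close>.
\<close>

lemma electric_field_eq_radiated:
  assumes "R \<le> norm x"
  shows "electric_field \<kappa> R J x $ i = radiated \<kappa> R (effective_source \<kappa> i) x"
proof -
  let ?c = "1 / complex_of_real (\<kappa>\<^sup>2)"
  let ?H = "\<lambda>i y j. J y $ j * partial i (partial j (green \<kappa> x)) y"
  note weak = weak_grad_div_green[OF grad_div J_L2 J_vanishes \<eta>_smooth \<eta>_one \<eta>_zero bR assms]
  have comp: "(green_tensor \<kappa> x y *v J y) $ i = J y $ i * green \<kappa> x y + ?c * (\<Sum>j\<in>UNIV. ?H i y j)"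
    if "y \<in> space M" for y i
  proof -
    have "x \<noteq> y" using that assms by auto
    then have "(green_tensor \<kappa> x y *v J y) $ i
        = (\<Sum>j\<in>UNIV. (mat 1 $ i $ j * green \<kappa> x y) * J y $ j + ?c * ?H i y j)"
      by (simp add: matrix_vector_mult_def green_tensor_def green_hessian_swap algebra_simps)
    also have "\<dots> = (\<Sum>j\<in>UNIV. (if j = i then J y $ i * green \<kappa> x y else 0) + ?c * ?H i y j)"
      by (intro sum.cong refl) (auto simp: mat_def)
    finally show ?thesis by (simp add: sum.distrib sum_distrib_left)
  qed
  have int: "integrable M (\<lambda>y. J y $ i * green \<kappa> x y + ?c * (\<Sum>j\<in>UNIV. ?H i y j))" for i
    by (intro Bochner_Integration.integrable_add integrable_mult_right
        Bochner_Integration.integrable_sum J_green(1) weak(1) assms)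
  have "electric_field \<kappa> R J x $ i = (LINT y|M. (green_tensor \<kappa> x y *v J y) $ i)"
    unfolding electric_field_def
    by (rule integral_vec_nth) (rule iffD2[OF Bochner_Integration.integrable_cong[OF refl comp] int])
  also have "\<dots> = (LINT y|M. J y $ i * green \<kappa> x y + ?c * (\<Sum>j\<in>UNIV. ?H i y j))"
    by (intro Bochner_Integration.integral_cong refl comp)
  also have "\<dots> = (LINT y|M. J y $ i * green \<kappa> x y) + ?c * (\<Sum>j\<in>UNIV. LINT y|M. ?H i y j)"
    by (subst Bochner_Integration.integral_add)
       (intro Bochner_Integration.integrable_add integrable_mult_right
        Bochner_Integration.integrable_sum J_green(1) weak(1) assms
        | simp add: Bochner_Integration.integral_sum weak(1))+
  finally show ?thesis
    by (simp add: radiated_effective_source[OF assms] weak(2))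
qed

text \<open>
  By the weak identity, the integral of \<open>W\<close> against the cut-off Green function is determined by \<open>J\<close>,
  hence is the same for all admissible cutoffs. Letting them increase to \<open>1\<close> on the whole ball removes the cutoff,
  by dominated convergence: for \<open>|x| > R\<close> the Green function is bounded on the ball.
\<close>

lemma integral_W_green_cutoff:
  assumes "R < norm x"
  shows "integrable M (\<lambda>y. W y $ i * green \<kappa> x y)"
    and "(LINT y|M. W y $ i * green \<kappa> x y) = (LINT y|M. W y $ i * (complex_of_real (\<eta> y) * green \<kappa> x y))"
proof -
  \<comment> \<open>Radii in the interval from \<open>r\<close> to \<open>R\<close>, tending to \<open>R\<close>; the \<open>n\<close>-th cutoff drops from \<open>1\<close> to \<open>0\<close>
    between \<open>a n\<close> and the midpoint of \<open>a n\<close> and \<open>R\<close>.\<close>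
  define a where "a = (\<lambda>n::nat. R - (R - r) / (real n + 1))"
  have rR: "r < R" using rb bR by simp
  have a_less: "a n < R" for n using rR by (simp add: a_def)
  have a_ge: "r \<le> a n" for n using rR
    by (simp add: a_def field_simps mult_right_mono)
  have "\<exists>h :: real^3 \<Rightarrow> real. (\<forall>k. k_diff_on k UNIV h) \<and> (\<forall>y. 0 \<le> h y \<and> h y \<le> 1) \<and> (\<forall>y. norm y \<le> a n \<longrightarrow> h y = 1)
        \<and> (\<forall>y. (a n + R) / 2 \<le> norm y \<longrightarrow> h y = (0::real))" for n
  proof -
    have "0 < a n" "a n < (a n + R) / 2" using a_less[of n] a_ge[of n] r by auto
    then obtain h :: "real^3 \<Rightarrow> real" where hh: "\<And>k. k_diff_on k UNIV h" "\<And>y. 0 \<le> h y" "\<And>y. h y \<le> 1"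
        "\<And>y. norm y \<le> a n \<Longrightarrow> h y = 1" "\<And>y. (a n + R) / 2 \<le> norm y \<Longrightarrow> h y = 0"
      by (rule smooth_cutoff_exists[where 'n=3]) blast
    show ?thesis by (rule exI[of _ h]) (use hh in blast)
  qed
  then obtain h :: "nat \<Rightarrow> real^3 \<Rightarrow> real" where h: "\<And>n k. k_diff_on k UNIV (h n)"
      "\<And>n y. 0 \<le> h n y" "\<And>n y. h n y \<le> 1" "\<And>n y. norm y \<le> a n \<Longrightarrow> h n y = 1"
      "\<And>n y. (a n + R) / 2 \<le> norm y \<Longrightarrow> h n y = 0"
    by metis
  have bound: "norm (green \<kappa> x y) \<le> 1 / (4 * pi * (norm x - R))" if "y \<in> space M" for y
  proof -
    have "norm x - R \<le> norm (x - y)"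
      using that norm_triangle_ineq2[of x y] by simp
    then show ?thesis unfolding norm_green using assms by (intro frac_le mult_left_mono) auto
  qed
  have meas: "green \<kappa> x \<in> borel_measurable M"
    using assms by (intro green_measurable) simp
  show int: "integrable M (\<lambda>y. W y $ i * green \<kappa> x y)"
    by (rule integrable_mult_bounded[OF W_int meas bound])
  have const: "(LINT y|M. W y $ i * (complex_of_real (h n y) * green \<kappa> x y))
      = (LINT y|M. W y $ i * (complex_of_real (\<eta> y) * green \<kappa> x y))" for n
  proof -
    have lt: "(a n + R) / 2 < R" using a_less[of n] by simp
    have one: "h n y = 1" if "norm y \<le> r" for y using that a_ge[of n] h(4) by force
    have R: "R \<le> norm x" using assms by simp
    show ?thesis
      by (rule trans[OF
          weak_grad_div_green(2)[OF grad_div J_L2 J_vanishes h(1)[of _ n] one h(5)[of n] lt R, symmetric]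
          weak_grad_div_green(2)[OF grad_div J_L2 J_vanishes \<eta>_smooth \<eta>_one \<eta>_zero bR R]])
  qed
  have "(\<lambda>n. LINT y|M. W y $ i * (complex_of_real (h n y) * green \<kappa> x y))
      \<longlonglongrightarrow> (LINT y|M. W y $ i * green \<kappa> x y)"
  proof (rule integral_dominated_convergence[where w="\<lambda>y. norm (W y $ i * green \<kappa> x y)"])
    show "AE y in M. (\<lambda>n. W y $ i * (complex_of_real (h n y) * green \<kappa> x y)) \<longlonglongrightarrow> W y $ i * green \<kappa> x y"
    proof (rule AE_I2)
      fix y assume "y \<in> space M"
      then have y: "norm y < R" by simp
      have "a \<longlonglongrightarrow> R" unfolding a_def by real_asymp
      then have "eventually (\<lambda>n. norm y < a n) sequentially" using y by (rule order_tendstoD)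
      then have "eventually (\<lambda>n. W y $ i * (complex_of_real (h n y) * green \<kappa> x y) = W y $ i * green \<kappa> x y) sequentially"
        by eventually_elim (simp add: h(4))
      then show "(\<lambda>n. W y $ i * (complex_of_real (h n y) * green \<kappa> x y)) \<longlonglongrightarrow> W y $ i * green \<kappa> x y"
        by (rule tendsto_eventually)
    qed
    show "AE y in M. norm (W y $ i * (complex_of_real (h n y) * green \<kappa> x y)) \<le> norm (W y $ i * green \<kappa> x y)" for n
      using h(2,3)[of n] by (intro AE_I2) (simp add: norm_mult mult_left_le_one_le mult_left_mono)
    have "h n \<in> borel_measurable M" for n
      by (intro lebesgue_on_ball_measurable k_diff_on_imp_continuous k_diff_on_subset[OF h(1)]) simp
    then show "(\<lambda>y. W y $ i * (complex_of_real (h n y) * green \<kappa> x y)) \<in> borel_measurable M" for n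
      using W_int[of i] meas by measurable
  qed (use int in auto)
  then show "(LINT y|M. W y $ i * green \<kappa> x y) = (LINT y|M. W y $ i * (complex_of_real (\<eta> y) * green \<kappa> x y))"
    unfolding const by (simp add: LIMSEQ_const_iff)
qed

text \<open>
  The kernel \<open>j\<^sub>0\<close> is a multiple of the difference of the outgoing and the incoming Green function, so both
  potentials appear. The integral involves \<open>W\<close> on the whole ball, which is where the removal of the
  cutoff is used.
\<close>

lemma bessel_integral_eq_radiated:
  assumes "\<kappa> > 0" "R < norm x"
  shows "(LINT y|M. spherical_bessel_j0 (\<kappa> * norm (x - y)) *\<^sub>R (J y + (1 / \<kappa>\<^sup>2) *\<^sub>R W y)) $ i
    = 2 * pi / (\<i> * \<kappa>) * (radiated \<kappa> R (effective_source \<kappa> i) x - radiated (- \<kappa>) R (effective_source \<kappa> i) x)"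
proof -
  let ?c = "1 / complex_of_real (\<kappa>\<^sup>2)"
  let ?g = "\<lambda>\<sigma> i y. J y $ i * green \<sigma> x y + ?c * (W y $ i * green \<sigma> x y)"
  have R: "R \<le> norm x" using assms by simp
  have alg: "(k * (g - g')) * (u + c * w) = k * ((u * g + c * (w * g)) - (u * g' + c * (w * g')))"
    for k g g' u c w :: complex by (simp add: algebra_simps)
  have comp: "(spherical_bessel_j0 (\<kappa> * norm (x - y)) *\<^sub>R (J y + (1 / \<kappa>\<^sup>2) *\<^sub>R W y)) $ i
      = 2 * pi / (\<i> * \<kappa>) * (?g \<kappa> i y - ?g (- \<kappa>) i y)" if "y \<in> space M" for i y
  proof -
    have "x \<noteq> y" using that R by auto
    then have "(spherical_bessel_j0 (\<kappa> * norm (x - y)) *\<^sub>R (J y + (1 / \<kappa>\<^sup>2) *\<^sub>R W y)) $ i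
      = (2 * pi / (\<i> * \<kappa>) * (green \<kappa> x y - green (- \<kappa>) x y)) * (J y $ i + ?c * W y $ i)"
      unfolding vector_scaleR_component vector_add_component
      by (simp add: scaleR_conv_of_real spherical_bessel_green[OF assms(1)])
    then show ?thesis by (simp only: alg)
  qed
  have intg: "integrable M (?g \<sigma> i)" for \<sigma> i
    by (intro Bochner_Integration.integrable_add integrable_mult_right
        J_green(1)[OF R] integral_W_green_cutoff(1)[OF assms(2)])
  have g: "(LINT y|M. ?g \<sigma> i y) = radiated \<sigma> R (effective_source \<kappa> i) x" for \<sigma>
    by (subst Bochner_Integration.integral_add)
       (intro integrable_mult_right J_green(1)[OF R] integral_W_green_cutoff(1)[OF assms(2)]
        | simp add: radiated_effective_source[OF R] integral_W_green_cutoff(2)[OF assms(2)])+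
  have int: "integrable M (\<lambda>y. 2 * pi / (\<i> * \<kappa>) * (?g \<kappa> i y - ?g (- \<kappa>) i y))" for i
    by (intro integrable_mult_right Bochner_Integration.integrable_diff intg)
  have "(LINT y|M. spherical_bessel_j0 (\<kappa> * norm (x - y)) *\<^sub>R (J y + (1 / \<kappa>\<^sup>2) *\<^sub>R W y)) $ i
      = (LINT y|M. (spherical_bessel_j0 (\<kappa> * norm (x - y)) *\<^sub>R (J y + (1 / \<kappa>\<^sup>2) *\<^sub>R W y)) $ i)"
    by (rule integral_vec_nth) (rule iffD2[OF Bochner_Integration.integrable_cong[OF refl comp] int])
  also have "\<dots> = (LINT y|M. 2 * pi / (\<i> * \<kappa>) * (?g \<kappa> i y - ?g (- \<kappa>) i y))"
    by (intro Bochner_Integration.integral_cong refl comp)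
  also have "\<dots> = 2 * pi / (\<i> * \<kappa>) * ((LINT y|M. ?g \<kappa> i y) - (LINT y|M. ?g (- \<kappa>) i y))"
    by (subst integral_mult_right_zero, subst Bochner_Integration.integral_diff) (intro intg refl)+
  finally show ?thesis by (simp only: g)
qed

end

section \<open>Holomorphic dependence of integrals on a parameter\<close>

text \<open>
  Cauchy's estimate, uniform in \<open>y\<close> by compactness, bounds the difference quotients of the kernel near
  \<open>s0\<close> by a constant; dominated convergence then differentiates under the integral.
\<close>

lemma holomorphic_on_integral_kernel:
  fixes k :: "complex \<Rightarrow> 'a::euclidean_space \<Rightarrow> complex" and f :: "'a \<Rightarrow> complex"
  assumes S: "open S" and K: "compact K"
    and cont: "continuous_on (S \<times> K) (\<lambda>(s, y). k s y)"
    and hol: "\<And>y. y \<in> K \<Longrightarrow> (\<lambda>s. k s y) holomorphic_on S"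
    and f: "integrable (lebesgue_on K) f"
  shows "(\<lambda>s. LINT y|lebesgue_on K. k s y * f y) holomorphic_on S"
proof (subst holomorphic_on_open[OF S], intro ballI allI)
  fix s0 assume "s0 \<in> S"
  then obtain r where r: "r > 0" "cball s0 (2 * r) \<subseteq> S"
    using open_contains_cball_eq[OF S] by (metis half_gt_zero mult.commute field_sum_of_halves mult_2 add.commute)
  have ballS: "s \<in> S" if "s \<in> ball s0 r" for s
    using that r(1) subsetD[OF r(2), of s] by auto
  let ?M = "lebesgue_on K"
  have spM: "space ?M = K" by simp
  have Kl: "K \<in> sets lebesgue" using K by (simp add: compact_imp_closed)
  have "compact ((\<lambda>(s, y). k s y) ` (cball s0 (2 * r) \<times> K))"
    using r K by (intro compact_continuous_image continuous_on_subset[OF cont] compact_Times) auto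
  then obtain C where C: "norm z \<le> C" if "z \<in> (\<lambda>(s, y). k s y) ` (cball s0 (2 * r) \<times> K)" for z
    using compact_imp_bounded bounded_iff by metis
  have kC: "norm (k s y) \<le> C" if "s \<in> cball s0 (2 * r)" "y \<in> K" for s y
    by (rule C) (use that in force)
  have kmeas: "k s \<in> borel_measurable ?M" if "s \<in> S" for s
  proof (rule continuous_imp_measurable_on_sets_lebesgue[OF _ Kl])
    have "continuous_on K ((\<lambda>(s, y). k s y) \<circ> (\<lambda>y. (s, y)))"
      using that by (intro continuous_on_compose continuous_intros continuous_on_subset[OF cont]) auto
    then show "continuous_on K (k s)" by (simp add: o_def)
  qed
  have lip: "norm (k s y - k s0 y) \<le> C / r * norm (s - s0)" if "s \<in> ball s0 r" "y \<in> K" for s y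
  proof (rule field_differentiable_bound[where S="ball s0 r" and f="\<lambda>s. k s y" and f'="deriv (\<lambda>s. k s y)"])
    fix z assume z: "z \<in> ball s0 r"
    have zS: "cball z r \<subseteq> cball s0 (2 * r)"
    proof
      fix w assume "w \<in> cball z r"
      then show "w \<in> cball s0 (2 * r)" using z dist_triangle[of s0 w z] by simp
    qed
    have "z \<in> S" using z by (rule ballS)
    show "((\<lambda>s. k s y) has_field_derivative deriv (\<lambda>s. k s y) z) (at z within ball s0 r)"
      by (rule has_field_derivative_at_within[OF holomorphic_derivI[OF hol[OF that(2)] S \<open>z \<in> S\<close>]])
    have "norm ((deriv ^^ 1) (\<lambda>s. k s y) z) \<le> fact 1 * C / r ^ 1"
    proof (rule Cauchy_inequality)
      show "(\<lambda>s. k s y) holomorphic_on ball z r"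
        using zS r by (intro holomorphic_on_subset[OF hol[OF that(2)]]) fastforce
      show "continuous_on (cball z r) (\<lambda>s. k s y)"
        using zS r by (intro continuous_on_subset[OF holomorphic_on_imp_continuous_on[OF hol[OF that(2)]]]) blast
      show "norm (k w y) \<le> C" if "norm (z - w) = r" for w
        using that zS \<open>y \<in> K\<close> by (intro kC) (auto simp: dist_norm)
    qed (use r in auto)
    then show "norm (deriv (\<lambda>s. k s y) z) \<le> C / r" by simp
  qed (use that r in auto)
  have int: "integrable ?M (\<lambda>y. k s y * f y)" if "s \<in> ball s0 r" for s
  proof -
    have "integrable ?M (\<lambda>y. f y * k s y)"
      using that r(1) by (intro integrable_mult_bounded[OF f, where C=C] kmeas kC ballS) auto
    then show ?thesis by (simp add: mult.commute)
  qed
  have "((\<lambda>s. ((LINT y|?M. k s y * f y) - (LINT y|?M. k s0 y * f y)) / (s - s0))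
      \<longlongrightarrow> (LINT y|?M. deriv (\<lambda>s. k s y) s0 * f y)) (at s0 within ball s0 r)"
    unfolding tendsto_at_iff_sequentially comp_def
  proof (intro allI impI)
    fix X :: "nat \<Rightarrow> complex"
    assume X: "\<forall>i. X i \<in> ball s0 r - {s0}" "X \<longlonglongrightarrow> s0"
    let ?q = "\<lambda>i y. (k (X i) y - k s0 y) / (X i - s0) * f y"
    have "filterlim X (at s0) sequentially"
      using X by (simp add: filterlim_at)
    have lim: "(\<lambda>i. ?q i y) \<longlonglongrightarrow> deriv (\<lambda>s. k s y) s0 * f y" if "y \<in> K" for y
    proof -
      have "((\<lambda>s. k s y) has_field_derivative deriv (\<lambda>s. k s y) s0) (at s0)"
        by (rule holomorphic_derivI[OF hol[OF that] S \<open>s0 \<in> S\<close>])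
      then have "((\<lambda>s. (k s y - k s0 y) / (s - s0)) \<longlongrightarrow> deriv (\<lambda>s. k s y) s0) (at s0)"
        by (simp add: has_field_derivative_iff)
      from filterlim_compose[OF this \<open>filterlim X (at s0) sequentially\<close>]
      show ?thesis by (intro tendsto_mult_right)
    qed
    have qmeas: "?q i \<in> borel_measurable ?M" for i
    proof -
      have "X i \<in> S" using X(1) by (intro ballS) blast
      from kmeas[OF this] kmeas[OF \<open>s0 \<in> S\<close>] f show ?thesis by measurable
    qed
    have tendsto: "(\<lambda>i. integral\<^sup>L ?M (?q i)) \<longlonglongrightarrow> (LINT y|?M. deriv (\<lambda>s. k s y) s0 * f y)"
    proof (rule integral_dominated_convergence[where w="\<lambda>y. C / r * norm (f y)"])
      show "(\<lambda>y. deriv (\<lambda>s. k s y) s0 * f y) \<in> borel_measurable ?M"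
        by (rule borel_measurable_LIMSEQ_metric[OF qmeas]) (use lim spM in auto)
      show "AE y in ?M. norm (?q i y) \<le> C / r * norm (f y)" for i
      proof (rule AE_I2)
        fix y assume "y \<in> space ?M"
        then have "norm (k (X i) y - k s0 y) \<le> C / r * norm (X i - s0)"
          using X(1) spM by (intro lip) auto
        then have "norm ((k (X i) y - k s0 y) / (X i - s0)) \<le> C / r"
          using X(1) by (simp add: norm_divide divide_le_eq)
        then show "norm (?q i y) \<le> C / r * norm (f y)"
          unfolding norm_mult by (rule mult_right_mono) simp
      qed
      show "integrable ?M (\<lambda>y. C / r * norm (f y))" using f by simp
      show "AE y in ?M. (\<lambda>i. ?q i y) \<longlonglongrightarrow> deriv (\<lambda>s. k s y) s0 * f y"
        using lim spM by (intro AE_I2) auto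
    qed (rule qmeas)
    have quotient: "integral\<^sup>L ?M (?q i)
        = ((LINT y|?M. k (X i) y * f y) - (LINT y|?M. k s0 y * f y)) / (X i - s0)" for i
    proof -
      have "?q i = (\<lambda>y. (k (X i) y * f y - k s0 y * f y) / (X i - s0))"
        by (simp add: left_diff_distrib)
      then show ?thesis
        using X(1) r by (simp add: Bochner_Integration.integral_diff[OF int int])
    qed
    show "(\<lambda>i. ((LINT y|?M. k (X i) y * f y) - (LINT y|?M. k s0 y * f y)) / (X i - s0))
        \<longlonglongrightarrow> (LINT y|?M. deriv (\<lambda>s. k s y) s0 * f y)"
      using tendsto unfolding quotient .
  qed
  then show "\<exists>D. ((\<lambda>s. LINT y|?M. k s y * f y) has_field_derivative D) (at s0)"
    using r by (auto simp: has_field_derivative_iff at_within_open[of s0 "ball s0 r"])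
qed

section \<open>The far field as a holomorphic function of the reciprocal radius\<close>

text \<open>
  For a unit vector \<open>e\<close> and small real \<open>s\<close> this is \<open>|e - s y|\<close>; the formula extends it to complex \<open>s\<close>.
\<close>

definition scaled_dist :: "real^3 \<Rightarrow> complex \<Rightarrow> real^3 \<Rightarrow> complex" where
  "scaled_dist e s y = csqrt (1 - 2 * s * complex_of_real (e \<bullet> y) + s\<^sup>2 * complex_of_real (y \<bullet> y))"

lemma mult_right_half_planes:
  assumes "Re z > 0" "Re w > 0"
  shows "z * w \<notin> \<real>\<^sub>\<le>\<^sub>0"
proof
  assume "z * w \<in> \<real>\<^sub>\<le>\<^sub>0"
  then have im: "Im (z * w) = 0" and re: "Re (z * w) \<le> 0" by (auto simp: complex_nonpos_Reals_iff)
  have "Re w * ((Re z)\<^sup>2 + (Im z)\<^sup>2) = Re (z * w) * Re z + Im (z * w) * Im z"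
    by (simp add: algebra_simps power2_eq_square)
  also have "\<dots> \<le> 0" using im re assms by (simp add: mult_nonpos_nonneg)
  finally show False
    using assms by (simp add: mult_le_0_iff sum_power2_le_zero_iff not_le)
qed

text \<open>
  The radicand is \<open>(1 - s a) (1 - s cnj a)\<close> with \<open>|a| = |y|\<close>. Both factors have positive real part, so
  their product avoids the branch cut of the square root.
\<close>

lemma scaled_dist_radicand:
  fixes e y :: "real^3"
  assumes "norm e = 1" "norm s * norm y < 1"
  shows "1 - 2 * s * complex_of_real (e \<bullet> y) + s\<^sup>2 * complex_of_real (y \<bullet> y) \<notin> \<real>\<^sub>\<le>\<^sub>0"
proof -
  define a where "a = Complex (e \<bullet> y) (sqrt (y \<bullet> y - (e \<bullet> y)\<^sup>2))"
  have "(e \<bullet> y)\<^sup>2 \<le> y \<bullet> y"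
    using Cauchy_Schwarz_ineq[of e y] assms(1) by (simp add: power2_norm_eq_inner[symmetric])
  then have na: "(Re a)\<^sup>2 + (Im a)\<^sup>2 = y \<bullet> y" by (simp add: a_def)
  then have norms: "norm a = norm y" "norm (cnj a) = norm y"
    by (simp_all add: cmod_def norm_eq_sqrt_inner)
  have re: "Re (1 - s * w) > 0" if "norm w = norm y" for w
  proof -
    have "Re (s * w) \<le> norm (s * w)" by (rule complex_Re_le_cmod)
    also have "\<dots> < 1" using assms that by (simp add: norm_mult)
    finally show ?thesis by simp
  qed
  have "a * cnj a = complex_of_real (y \<bullet> y)"
    unfolding complex_mult_cnj na ..
  moreover have "a + cnj a = 2 * complex_of_real (e \<bullet> y)"
    by (simp add: complex_eq_iff a_def)
  moreover have "(1 - s * a) * (1 - s * cnj a) = 1 - s * (a + cnj a) + s\<^sup>2 * (a * cnj a)"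
    by (simp add: algebra_simps power2_eq_square)
  ultimately have "1 - 2 * s * complex_of_real (e \<bullet> y) + s\<^sup>2 * complex_of_real (y \<bullet> y)
      = (1 - s * a) * (1 - s * cnj a)" by simp
  then show ?thesis
    using mult_right_half_planes[OF re re] norms by simp
qed

lemma scaled_dist_nonzero:
  assumes "norm e = 1" "norm s * norm y < 1"
  shows "scaled_dist e s y \<noteq> 0" "scaled_dist e s y + 1 \<noteq> 0"
proof -
  note rad = scaled_dist_radicand[OF assms]
  then show "scaled_dist e s y \<noteq> 0" unfolding scaled_dist_def by auto
  have "Re (scaled_dist e s y) \<ge> 0" unfolding scaled_dist_def by (rule Re_csqrt)
  then show "scaled_dist e s y + 1 \<noteq> 0" by (auto simp: complex_eq_iff)
qed

text \<open>
  With \<open>\<rho> = scaled_dist e s y\<close>, the exponent is \<open>i \<kappa> (\<rho> - 1) / s\<close>, that is, the phase relative to a wave emitted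
  from the origin. Writing \<open>(\<rho> - 1) / s = (\<rho>\<^sup>2 - 1) / (s (\<rho> + 1))\<close> and cancelling \<open>s\<close> exposes
  that it is regular at \<open>s = 0\<close>.
\<close>

definition far_kernel :: "real \<Rightarrow> real^3 \<Rightarrow> complex \<Rightarrow> real^3 \<Rightarrow> complex" where
  "far_kernel \<kappa> e s y =
     exp (\<i> * complex_of_real \<kappa> * (s * complex_of_real (y \<bullet> y) - 2 * complex_of_real (e \<bullet> y))
          / (scaled_dist e s y + 1)) / (4 * pi * scaled_dist e s y)"

definition far_field :: "real \<Rightarrow> real \<Rightarrow> (real^3 \<Rightarrow> complex) \<Rightarrow> real^3 \<Rightarrow> complex \<Rightarrow> complex" where
  "far_field \<kappa> b f e s = (LINT y|lebesgue_on (cball 0 b). far_kernel \<kappa> e s y * f y)"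

lemma small_parameter:
  assumes "b > 0" "s \<in> ball (0::complex) (1 / b)" "y \<in> cball (0::real^3) b"
  shows "norm s * norm y < 1"
proof -
  have "norm s * norm y \<le> norm s * b" using assms by (intro mult_left_mono) auto
  also have "\<dots> < 1" using assms by (simp add: field_simps)
  finally show ?thesis .
qed

lemma holomorphic_far_field:
  assumes "norm e = 1" "b > 0" "integrable (lebesgue_on (cball 0 b)) f"
  shows "far_field \<kappa> b f e holomorphic_on ball 0 (1 / b)"
  unfolding far_field_def[abs_def]
proof (rule holomorphic_on_integral_kernel)
  let ?D = "ball (0::complex) (1 / b) \<times> cball (0::real^3) b"
  note ok = small_parameter[OF assms(2)]
  have c1: "continuous_on ?D (\<lambda>p. scaled_dist e (fst p) (snd p))"
    unfolding scaled_dist_def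
    by (rule continuous_on_compose2[OF continuous_on_csqrt])
       (use scaled_dist_radicand[OF assms(1)] ok in \<open>auto intro!: continuous_intros\<close>)
  have "continuous_on ?D (\<lambda>p. far_kernel \<kappa> e (fst p) (snd p))"
    unfolding far_kernel_def
    by (intro continuous_intros c1) (use scaled_dist_nonzero[OF assms(1)] ok in auto)
  then show "continuous_on ?D (\<lambda>(s, y). far_kernel \<kappa> e s y)"
    by (simp add: case_prod_beta)
  fix y assume y: "y \<in> cball (0::real^3) b"
  have h1: "(\<lambda>s. scaled_dist e s y) holomorphic_on ball 0 (1 / b)"
    unfolding scaled_dist_def
    by (intro holomorphic_intros) (use scaled_dist_radicand[OF assms(1)] ok y in auto)
  show "(\<lambda>s. far_kernel \<kappa> e s y) holomorphic_on ball 0 (1 / b)"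
    unfolding far_kernel_def
    by (intro holomorphic_intros h1) (use scaled_dist_nonzero[OF assms(1)] ok y in auto)
qed (use assms in auto)

text \<open>
  Continuing the outgoing far field through \<open>0\<close> to negative parameters produces the incoming far field
  in the opposite direction; this is what links the two kinds of waves.
\<close>

lemma far_kernel_reflect: "far_kernel \<kappa> e (- s) y = far_kernel (- \<kappa>) (- e) s y"
proof -
  have "scaled_dist e (- s) y = scaled_dist (- e) s y" by (simp add: scaled_dist_def)
  moreover have "\<i> * complex_of_real \<kappa> * (- s * complex_of_real (y \<bullet> y) - 2 * complex_of_real (e \<bullet> y))
     = \<i> * complex_of_real (- \<kappa>) * (s * complex_of_real (y \<bullet> y) - 2 * complex_of_real (- e \<bullet> y))"
    by (simp add: algebra_simps)
  ultimately show ?thesis by (simp only: far_kernel_def)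
qed

lemma far_field_reflect: "far_field \<kappa> b f e (- s) = far_field (- \<kappa>) b f (- e) s"
  by (simp only: far_field_def far_kernel_reflect)

lemma green_eq_far_kernel:
  assumes "norm e = 1" "0 < t" "t * norm y < 1"
  shows "green \<kappa> ((1 / t) *\<^sub>R e) y
    = t * exp (\<i> * complex_of_real (\<kappa> / t)) * far_kernel \<kappa> e (complex_of_real t) y"
proof -
  define d where "d = norm (e - t *\<^sub>R y)"
  have d2: "d\<^sup>2 = 1 - 2 * t * (e \<bullet> y) + t\<^sup>2 * (y \<bullet> y)"
  proof -
    have "e \<bullet> e = 1" using assms(1) by (simp add: norm_eq_1)
    then show ?thesis unfolding d_def power2_norm_eq_inner
      by (simp add: inner_diff_left inner_diff_right inner_commute[of y e] power2_eq_square algebra_simps)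
  qed
  have "norm (t *\<^sub>R y) < norm e" using assms by simp
  then have d: "d > 0" unfolding d_def by auto
  have sd: "scaled_dist e (complex_of_real t) y = complex_of_real d"
  proof -
    have "1 - 2 * complex_of_real t * complex_of_real (e \<bullet> y) + (complex_of_real t)\<^sup>2 * complex_of_real (y \<bullet> y)
       = complex_of_real (d\<^sup>2)" unfolding d2 by simp
    then show ?thesis unfolding scaled_dist_def using d by (simp add: csqrt_of_real_nonneg del: of_real_power)
  qed
  have dist: "norm ((1 / t) *\<^sub>R e - y) = d / t"
  proof -
    have "(1 / t) *\<^sub>R e - y = (1 / t) *\<^sub>R (e - t *\<^sub>R y)"
      using assms(2) by (simp add: scaleR_right_diff_distrib)
    then show ?thesis using assms(2) by (simp add: d_def)
  qed
  have "d / t = 1 / t + (t * (y \<bullet> y) - 2 * (e \<bullet> y)) / (d + 1)"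
  proof -
    have "t * (t * (y \<bullet> y) - 2 * (e \<bullet> y)) = (d - 1) * (d + 1)"
      using d2 by (simp add: algebra_simps power2_eq_square)
    then have "(t * (y \<bullet> y) - 2 * (e \<bullet> y)) / (d + 1) = (d - 1) / t"
      using d assms(2) by (simp add: field_simps)
    then show ?thesis by (simp add: diff_divide_distrib)
  qed
  then have "\<kappa> * (d / t) = \<kappa> / t + \<kappa> * (t * (y \<bullet> y) - 2 * (e \<bullet> y)) / (d + 1)"
    by (simp add: distrib_left)
  then have "exp (\<i> * complex_of_real (\<kappa> * (d / t)))
      = exp (\<i> * complex_of_real (\<kappa> / t)) *
        exp (\<i> * complex_of_real (\<kappa> * (t * (y \<bullet> y) - 2 * (e \<bullet> y)) / (d + 1)))"
    by (simp only: of_real_add distrib_left exp_add)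
  moreover have "\<i> * complex_of_real (\<kappa> * (t * (y \<bullet> y) - 2 * (e \<bullet> y)) / (d + 1))
     = \<i> * complex_of_real \<kappa> * (complex_of_real t * complex_of_real (y \<bullet> y) - 2 * complex_of_real (e \<bullet> y))
          / (complex_of_real d + 1)"
    by simp
  ultimately show ?thesis
    unfolding green_def far_kernel_def sd dist by (simp add: mult_ac)
qed

text \<open>
  The Atkinson-Wilcox factorisation: up to the factor of a spherical wave, the potential along a ray is
  a holomorphic function of the reciprocal distance \<open>t\<close>.
\<close>

lemma radiated_eq_far_field:
  assumes "norm e = 1" "0 < t" "t < 1 / b" "0 < b" "b < R" "\<And>y. b \<le> norm y \<Longrightarrow> f y = 0"
  shows "radiated \<kappa> R f ((1 / t) *\<^sub>R e)
    = t * exp (\<i> * complex_of_real (\<kappa> / t)) * far_field \<kappa> b f e (complex_of_real t)"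
proof -
  let ?h = "\<lambda>y. green \<kappa> ((1 / t) *\<^sub>R e) y * f y"
  have "radiated \<kappa> R f ((1 / t) *\<^sub>R e) = (LINT y|lebesgue. indicator (ball 0 R) y *\<^sub>R ?h y)"
    unfolding radiated_def by (rule integral_restrict_space) simp
  also have "\<dots> = (LINT y|lebesgue. indicator (cball 0 b) y *\<^sub>R ?h y)"
    using assms(5,6) by (intro Bochner_Integration.integral_cong) (auto simp: indicator_def)
  also have "\<dots> = (LINT y|lebesgue_on (cball 0 b). ?h y)"
    by (rule integral_restrict_space[symmetric]) simp
  also have "\<dots> = (LINT y|lebesgue_on (cball 0 b).
      t * exp (\<i> * complex_of_real (\<kappa> / t)) * (far_kernel \<kappa> e (complex_of_real t) y * f y))"
  proof (intro Bochner_Integration.integral_cong refl)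
    fix y :: "real^3" assume "y \<in> space (lebesgue_on (cball 0 b))"
    then have "t * norm y < 1"
      using small_parameter[OF assms(4), of "complex_of_real t" y] assms(2,3) by simp
    then show "?h y = t * exp (\<i> * complex_of_real (\<kappa> / t)) * (far_kernel \<kappa> e (complex_of_real t) y * f y)"
      by (simp only: green_eq_far_kernel[OF assms(1,2)] mult.assoc)
  qed
  finally show ?thesis by (simp only: integral_mult_right_zero far_field_def)
qed

section \<open>Uniqueness of outgoing and incoming waves\<close>

text \<open>
  Factoring out the zero of \<open>G\<close> at \<open>0\<close> leaves a holomorphic \<open>g\<close> with \<open>g 0 \<noteq> 0\<close>; but on the negative
  imaginary axis exponential decay survives the division by a power of \<open>t\<close>, which forces \<open>g 0 = 0\<close>.
\<close>

lemma flat_holomorphic_zero: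
  assumes G: "G holomorphic_on ball 0 \<delta>" and "\<delta> > 0" "c > 0"
    and flat: "\<And>t. 0 < t \<Longrightarrow> t < \<delta> \<Longrightarrow> norm (G (- \<i> * complex_of_real t)) \<le> C t * exp (- c / t)"
    and C: "(C \<longlongrightarrow> L) (at_right 0)"
    and "s \<in> ball 0 \<delta>"
  shows "G s = 0"
proof -
  have path: "((\<lambda>t. - \<i> * complex_of_real t) \<longlongrightarrow> 0) (at_right 0)"
    by (rule tendsto_eq_intros refl | simp)+
  have small: "((\<lambda>t. C t * (exp (- c / t) / t ^ n)) \<longlongrightarrow> 0) (at_right 0)" for n
  proof -
    have "((\<lambda>t. exp (- c / t) / t ^ n) \<longlongrightarrow> 0) (at_right 0)"
      using assms(3) by real_asymp
    from tendsto_mult[OF C this] show ?thesis by simp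
  qed
  have vanish: "g 0 = 0" if g: "isCont g 0" and r: "r > 0"
    and eq: "\<And>w. w \<in> ball 0 r \<Longrightarrow> G w = w ^ n * g w" for g n r
  proof -
    have "((\<lambda>t. g (- \<i> * complex_of_real t)) \<longlongrightarrow> 0) (at_right 0)"
    proof (rule Lim_null_comparison[OF _ small[of n]])
      have "eventually (\<lambda>t. 0 < t \<and> t < min r \<delta>) (at_right (0::real))"
        using r assms(2) by (intro eventually_at_rightI[of 0 "min r \<delta>"]) auto
      then show "eventually (\<lambda>t. norm (g (- \<i> * complex_of_real t)) \<le> C t * (exp (- c / t) / t ^ n)) (at_right 0)"
      proof eventually_elim
        case (elim t)
        have "norm (G (- \<i> * complex_of_real t)) = t ^ n * norm (g (- \<i> * complex_of_real t))"
          using elim by (subst eq) (auto simp: norm_mult norm_power)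
        with flat[of t] elim show ?case by (simp add: field_simps)
      qed
    qed
    moreover have "((\<lambda>t. g (- \<i> * complex_of_real t)) \<longlongrightarrow> g 0) (at_right 0)"
      using isCont_tendsto_compose[OF g path] .
    ultimately show ?thesis
      using tendsto_unique trivial_limit_at_right_real by blast
  qed
  have cont: "isCont g 0" if "g holomorphic_on ball 0 r" "r > 0" for g r
    using that holomorphic_on_imp_continuous_on continuous_on_eq_continuous_at[of "ball 0 r" g] by auto
  \<comment> \<open>The case \<open>g = G\<close> and \<open>n = 0\<close>, which provides the zero to be factored out.\<close>
  have G0: "G 0 = 0"
    by (rule vanish[where n=0 and r=\<delta>]) (use cont[OF G] assms(2) in auto)
  have "G constant_on ball 0 \<delta>"
  proof (rule ccontr)
    assume "\<not> G constant_on ball 0 \<delta>"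
    then obtain g r n where "0 < r" "g holomorphic_on ball 0 r"
        "\<And>w. w \<in> ball 0 r \<Longrightarrow> G w = (w - 0) ^ n * g w" "\<And>w. w \<in> ball 0 r \<Longrightarrow> g w \<noteq> 0"
      using holomorphic_factor_zero_nonconstant[OF G, of 0] G0 assms(2)
      by (metis centre_in_ball connected_ball open_ball)
    then show False using vanish[of g r n] cont[of g r] by auto
  qed
  then show ?thesis using G0 assms(2,6) by (metis centre_in_ball constant_on_def)
qed

lemma analytic_continuation_real_interval:
  assumes "F holomorphic_on S" "open S" "connected S" "0 < q" "complex_of_real ` {0<..<q} \<subseteq> S"
    and "\<And>t. 0 < t \<Longrightarrow> t < q \<Longrightarrow> F (complex_of_real t) = 0" "w \<in> S"
  shows "F w = 0"
proof (rule analytic_continuation[OF assms(1-3) assms(5) _ _ _ assms(7)])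
  show "complex_of_real (q / 2) \<in> S" using assms(4) by (intro subsetD[OF assms(5)] imageI) simp
  have "q / 2 islimpt {0<..<q}"
    using assms(4) by (intro interior_limit_point) (simp add: interior_open)
  then show "complex_of_real (q / 2) islimpt (complex_of_real ` {0<..<q})"
    unfolding islimpt_approachable by (simp add: dist_of_real del: of_real_divide)
qed (use assms(6) in auto)

context
  fixes b R \<kappa> :: real and f :: "real^3 \<Rightarrow> complex"
  assumes b: "0 < b" and bR: "b < R"
    and f_int: "integrable (lebesgue_on (ball 0 R)) f"
    and f_zero: "\<And>y. b \<le> norm y \<Longrightarrow> f y = 0"
begin

lemma f_int_cball: "integrable (lebesgue_on (cball 0 b)) f"
proof -
  have "integrable lebesgue (\<lambda>y. indicator (ball 0 R) y *\<^sub>R f y)"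
    using f_int by (subst (asm) integrable_restrict_space) auto
  also have "(\<lambda>y. indicator (ball 0 R) y *\<^sub>R f y) = (\<lambda>y. indicator (cball 0 b) y *\<^sub>R f y)"
    using bR f_zero by (auto simp: indicator_def fun_eq_iff)
  finally show ?thesis by (subst integrable_restrict_space) auto
qed

lemma radiated_polar:
  assumes "b < norm x"
  shows "radiated \<sigma> R f x
    = 1 / norm x * exp (\<i> * complex_of_real (\<sigma> * norm x)) * far_field \<sigma> b f (sgn x) (complex_of_real (1 / norm x))"
proof -
  have "x \<noteq> 0" using assms b by auto
  then have "x = (1 / (1 / norm x)) *\<^sub>R sgn x" by (simp add: sgn_div_norm)
  moreover have "norm (sgn x) = 1" "0 < 1 / norm x" "1 / norm x < 1 / b"
    using \<open>x \<noteq> 0\<close> assms b by (auto simp: norm_sgn frac_less2)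
  ultimately show ?thesis
    using radiated_eq_far_field[of "sgn x" "1 / norm x" b R f \<sigma>] b bR f_zero by simp
qed

lemma holomorphic_far: "norm e = 1 \<Longrightarrow> far_field \<sigma> b f e holomorphic_on ball 0 (1 / b)"
  by (rule holomorphic_far_field[OF _ b f_int_cball])

lemma far_field_eq_0_imp_radiated:
  assumes "\<And>e s. norm e = 1 \<Longrightarrow> s \<in> ball 0 (1 / b) \<Longrightarrow> far_field \<sigma> b f e s = 0" "b < norm x"
  shows "radiated \<sigma> R f x = 0"
proof -
  have "complex_of_real (1 / norm x) \<in> ball 0 (1 / b)" "norm (sgn x) = 1"
    using assms(2) b by (auto simp: norm_sgn norm_divide frac_less2)
  then show ?thesis using assms(1) by (simp add: radiated_polar[OF assms(2)])
qed

lemma radiated_at: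
  assumes "norm e = 1" "0 < t" "t < 1 / R"
  shows "radiated \<sigma> R f ((1 / t) *\<^sub>R e)
    = t * exp (\<i> * complex_of_real (\<sigma> / t)) * far_field \<sigma> b f e (complex_of_real t)"
    and "R < norm ((1 / t) *\<^sub>R e)"
proof -
  have "1 / R < 1 / b" using b bR by (simp add: frac_less2)
  then show "radiated \<sigma> R f ((1 / t) *\<^sub>R e)
    = t * exp (\<i> * complex_of_real (\<sigma> / t)) * far_field \<sigma> b f e (complex_of_real t)"
    using assms by (intro radiated_eq_far_field b bR f_zero) auto
  show "R < norm ((1 / t) *\<^sub>R e)" using assms b bR by (simp add: field_simps)
qed

lemma subset_discs: "complex_of_real ` {0<..<1 / R} \<subseteq> ball 0 (1 / b) - {0}"
proof -
  have "1 / R < 1 / b" using b bR by (simp add: frac_less2)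
  then show ?thesis by auto
qed

text \<open>
  The identity theorem makes all outgoing far fields zero on their whole disc, in particular at negative
  parameters, where they are the incoming far fields in the opposite directions.
\<close>

lemma outgoing_zero_imp_incoming_zero:
  assumes "\<And>x. R < norm x \<Longrightarrow> radiated \<kappa> R f x = 0" "b < norm x"
  shows "radiated (- \<kappa>) R f x = 0"
proof (rule far_field_eq_0_imp_radiated[OF _ assms(2)])
  have zero: "far_field \<kappa> b f e s = 0" if e: "norm e = 1" and s: "s \<in> ball 0 (1 / b)" for e s
  proof (rule analytic_continuation_real_interval[OF holomorphic_far[OF e] _ _ _ _ _ s])
    fix t :: real assume "0 < t" "t < 1 / R"
    with radiated_at(1)[OF e, of t \<kappa>] radiated_at(2)[OF e, of t] assms(1) show "far_field \<kappa> b f e (complex_of_real t) = 0" by simp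
  qed (use b bR subset_discs in auto)
  show "far_field (- \<kappa>) b f e s = 0" if "norm e = 1" "s \<in> ball 0 (1 / b)" for e s
    using zero[of "- e" "- s"] that far_field_reflect[of \<kappa> b f "- e" s] by simp
qed

text \<open>
  Equality of the potentials continues to \<open>exp (2 i \<kappa> / z) A\<^sub>\<kappa> z = A\<^sub>-\<^sub>\<kappa> z\<close> on a punctured disc about \<open>0\<close>.
  The exponential has an essential singularity there, so two functions holomorphic at \<open>0\<close> can only be
  related in this way if both are zero: on the negative imaginary axis the exponential decays faster than
  every power.
\<close>

lemma outgoing_eq_incoming_imp_zero:
  assumes "\<kappa> > 0" "\<And>x. R < norm x \<Longrightarrow> radiated \<kappa> R f x = radiated (- \<kappa>) R f x" "b < norm x"
  shows "radiated (- \<kappa>) R f x = 0"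
proof (rule far_field_eq_0_imp_radiated[OF _ assms(3)])
  fix e :: "real^3" and s :: complex
  assume e: "norm e = 1" and s: "s \<in> ball 0 (1 / b)"
  let ?A = "\<lambda>\<sigma>. far_field \<sigma> b f e"
  have eq: "exp (2 * \<i> * complex_of_real \<kappa> / z) * ?A \<kappa> z - ?A (- \<kappa>) z = 0" if "z \<in> ball 0 (1 / b) - {0}" for z
  proof (rule analytic_continuation_real_interval[OF _ _ _ _ subset_discs _ that])
    have hol: "?A \<sigma> holomorphic_on ball 0 (1 / b) - {0}" for \<sigma>
      by (rule holomorphic_on_subset[OF holomorphic_far[OF e]]) auto
    show "(\<lambda>z. exp (2 * \<i> * complex_of_real \<kappa> / z) * ?A \<kappa> z - ?A (- \<kappa>) z) holomorphic_on ball 0 (1 / b) - {0}"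
      by (intro holomorphic_intros hol) auto
    show "connected (ball (0::complex) (1 / b) - {0})"
      by (intro connected_punctured_ball) simp
    fix t :: real assume t: "0 < t" "t < 1 / R"
    let ?E = "exp (\<i> * complex_of_real (\<kappa> / t))" and ?E' = "exp (\<i> * complex_of_real (- \<kappa> / t))"
    have "2 * \<i> * complex_of_real \<kappa> / complex_of_real t
        = \<i> * complex_of_real (\<kappa> / t) + \<i> * complex_of_real (\<kappa> / t)" by simp
    then have E: "exp (2 * \<i> * complex_of_real \<kappa> / complex_of_real t) = ?E * ?E"
      by (simp only: exp_add)
    have "?E * ?E' = exp (\<i> * complex_of_real (\<kappa> / t + - \<kappa> / t))"
      by (simp only: exp_add[symmetric] distrib_left[symmetric] of_real_add[symmetric])
    then have E': "?E * ?E' = 1" by simp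
    have "?E * ?A \<kappa> (complex_of_real t) = ?E' * ?A (- \<kappa>) (complex_of_real t)"
      using assms(2)[OF radiated_at(2)[OF e t]] t(1) unfolding radiated_at(1)[OF e t] by simp
    then have "(?E * ?E) * ?A \<kappa> (complex_of_real t) = (?E * ?E') * ?A (- \<kappa>) (complex_of_real t)"
      by (simp only: mult.assoc)
    then show "exp (2 * \<i> * complex_of_real \<kappa> / complex_of_real t) * ?A \<kappa> (complex_of_real t)
        - ?A (- \<kappa>) (complex_of_real t) = 0"
      by (simp only: E E' mult_1 diff_self)
  qed (use b bR in auto)
  show "?A (- \<kappa>) s = 0"
  proof (rule flat_holomorphic_zero[OF holomorphic_far[OF e] _ _ _ _ s])
    show "norm (?A (- \<kappa>) (- \<i> * complex_of_real t))
        \<le> norm (?A \<kappa> (- \<i> * complex_of_real t)) * exp (- (2 * \<kappa>) / t)" if "0 < t" "t < 1 / b" for t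
    proof -
      have "2 * \<i> * complex_of_real \<kappa> / (- \<i> * complex_of_real t) = complex_of_real (- (2 * \<kappa>) / t)"
        using that by (simp add: field_simps)
      moreover have "?A (- \<kappa>) (- \<i> * complex_of_real t)
          = exp (2 * \<i> * complex_of_real \<kappa> / (- \<i> * complex_of_real t)) * ?A \<kappa> (- \<i> * complex_of_real t)"
        using eq[of "- \<i> * complex_of_real t"] that by (simp add: norm_mult)
      ultimately show ?thesis
        by (simp only: norm_mult norm_exp_eq_Re Re_complex_of_real mult.commute order_refl)
    qed
    have "isCont (?A \<kappa>) 0"
      using holomorphic_on_imp_continuous_on[OF holomorphic_far[OF e, of \<kappa>]] b
        continuous_on_eq_continuous_at[of "ball 0 (1 / b)" "?A \<kappa>"] by auto
    then show "((\<lambda>t. norm (?A \<kappa> (- \<i> * complex_of_real t))) \<longlongrightarrow> norm (?A \<kappa> 0)) (at_right 0)"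
      by (intro tendsto_norm isCont_tendsto_compose[where g="?A \<kappa>"])
         (rule tendsto_eq_intros refl | simp)+
  qed (use assms(1) b in auto)
qed

end

section \<open>Nonradiating sources and the null space\<close>

theorem theorem3p11:
  fixes \<kappa> R :: real and J :: "real^3 \<Rightarrow> complex^3"
  assumes "\<kappa> > 0" and "R > 0"
    and "J \<in> H_div_grad (ball 0 R)"
    and "compact (ess_support (ball 0 R) J)"
  shows "nonradiating \<kappa> R J \<longleftrightarrow> J \<in> null_space3 \<kappa> R"
proof -
  define W where "W = grad_div (ball 0 R) J"
  have "\<exists>W. has_grad_div (ball 0 R) J W" using assms(3) by (simp add: H_div_grad_def)
  then have W: "has_grad_div (ball 0 R) J W" unfolding W_def grad_div_def by (rule someI_ex)
  have J: "J \<in> L2_on (ball 0 R)" using assms(3) by (simp add: H_div_grad_def)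
  obtain r where r: "0 < r" "r < R" "ess_support (ball 0 R) J \<subseteq> ball 0 r"
    using compact_subset_smaller_ball[OF assms(4) _ assms(2)] by (auto simp: ess_support_def)
  define b where "b = (r + R) / 2"
  have b: "r < b" "b < R" "0 < b" using r by (auto simp: b_def)
  obtain \<eta> :: "real^3 \<Rightarrow> real" where \<eta>: "\<And>k. k_diff_on k UNIV \<eta>"
      "\<And>y. norm y \<le> r \<Longrightarrow> \<eta> y = 1" "\<And>y. b \<le> norm y \<Longrightarrow> \<eta> y = 0"
    using smooth_cutoff_exists[OF r(1) b(1), where 'n=3] by metis
  interpret truncated_source R r b J W \<eta>
  proof
    show "AE y in lebesgue_on (ball 0 R). r \<le> norm y \<longrightarrow> J y = 0"
      by (rule AE_mp[OF AE_zero_off_ess_support[of "ball 0 R" J]])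
         (use r(3) in \<open>auto intro!: AE_I2\<close>)
  qed (use r b W J \<eta> in auto)
  let ?F = "effective_source \<kappa>"
  let ?N = "\<lambda>x. LINT y|M. spherical_bessel_j0 (\<kappa> * norm (x - y)) *\<^sub>R (J y + (1 / \<kappa>\<^sup>2) *\<^sub>R W y)"
  note uniqueness = b(3) b(2) effective_source_integrable effective_source_zero
  have E: "nonradiating \<kappa> R J \<longleftrightarrow> (\<forall>x i. R \<le> norm x \<longrightarrow> radiated \<kappa> R (?F i) x = 0)"
    unfolding nonradiating_def
    by (auto simp: vec_eq_iff not_less electric_field_eq_radiated)
  have "J \<in> null_space3 \<kappa> R \<longleftrightarrow> (\<forall>x. R < norm x \<longrightarrow> ?N x = 0)"
    using assms(3) by (simp add: null_space3_def W_def)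
  also have "\<dots> \<longleftrightarrow> (\<forall>x i. R < norm x \<longrightarrow> ?N x $ i = 0)"
    by (auto simp: vec_eq_iff)
  also have "\<dots> \<longleftrightarrow> (\<forall>x i. R < norm x \<longrightarrow> radiated \<kappa> R (?F i) x = radiated (- \<kappa>) R (?F i) x)"
    using assms(1) by (auto simp: bessel_integral_eq_radiated)
  finally have N: "J \<in> null_space3 \<kappa> R
      \<longleftrightarrow> (\<forall>x i. R < norm x \<longrightarrow> radiated \<kappa> R (?F i) x = radiated (- \<kappa>) R (?F i) x)" .
  show ?thesis
    unfolding E N
  proof (intro iffI allI impI)
    fix x :: "real^3" and i
    assume zero: "\<forall>x i. R \<le> norm x \<longrightarrow> radiated \<kappa> R (?F i) x = 0" and x: "R < norm x"
    have "radiated (- \<kappa>) R (?F i) x = 0"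
      by (rule outgoing_zero_imp_incoming_zero[OF uniqueness]) (use zero x b in auto)
    then show "radiated \<kappa> R (?F i) x = radiated (- \<kappa>) R (?F i) x"
      using zero x by simp
  next
    fix x :: "real^3" and i
    assume eq: "\<forall>x i. R < norm x \<longrightarrow> radiated \<kappa> R (?F i) x = radiated (- \<kappa>) R (?F i) x"
      and x: "R \<le> norm x"
    have incoming: "radiated (- \<kappa>) R (?F i) z = 0" if "R < norm z" for z
      by (rule outgoing_eq_incoming_imp_zero[OF uniqueness assms(1)]) (use eq that b in auto)
    \<comment> \<open>Exchanging the roles of \<open>\<kappa>\<close> and \<open>- \<kappa>\<close> yields the statement for \<open>\<kappa>\<close> on the sphere of radius \<open>R\<close> too.\<close>
    have "radiated (- (- \<kappa>)) R (?F i) x = 0"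
      by (rule outgoing_zero_imp_incoming_zero[OF uniqueness]) (use incoming x b in auto)
    then show "radiated \<kappa> R (?F i) x = 0" by simp
  qed
qed

end
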